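(* For each $j\in\mathbb Z$, the family $\{\Phi_{j,k,m}:k\in\mathbb Z,\ m\in\mathbb Z^2\}$ is a unit-norm $b^{-1}$-tight frame for $V_j$, and the family $\{\Psi^\ell_{j,k,m}:k\in\mathbb Z,\ m\in\mathbb Z^2,\ \ell=1,\dots,15\}$ is a unit-norm $b^{-1}$-tight frame for $W_j$.
   Context: Fourier transform: $\widehat f(\xi)=\int f(x)e^{-2\pi i x\cdot\xi}dx$, extended to $L^2$. A family $\{\varphi_i\}$ in a Hilbert space $\mathcal H$ is an $a$-tight frame for $\mathcal H$ if $\sum_i|\langle f,\varphi_i\rangle|^2=a\|f\|^2$ for all $f\in\mathcal H$; it is unit-norm if every $\|\varphi_i\|=1$. Let $\phi$ be an orthogonal scaling function of a $16$-band multiresolution analysis (dilation factor $16$) in $L^2(\mathbb R)$, with associated orthonormal wavelets $\psi_1,\dots,\psi_{15}$. Let $b>0$ and let $w\in L^2(\mathbb R)$ be a unit-norm window of a $b^{-1}$-tight Gabor frame, i.e. the functions $x\mapsto e^{2\pi i m b x}w(x-k)$, $m,k\in\mathbb Z$, form a $b^{-1}$-tight frame for $L^2(\mathbb R)$. For $\xi=(\xi_1,\xi_2)$ with $\xi_1\neq0$ put $\gamma_1(\xi)=\frac12\mathrm{sgn}(\xi_1)\xi_1^2$ and $\gamma_2(\xi)=\xi_2/\xi_1$. For $j,k\in\mathbb Z$, $m=(m_1,m_2)\in\mathbb Z^2$, $1\le\ell\le15$, the functions $\Phi_{j,k,m},\Psi^\ell_{j,k,m}\in L^2(\mathbb R^2)$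 are defined by $$\widehat{\Phi_{j,k,m}}(\xi)=2^{-3j/2}\,\widehat\phi(2^{-4j}\gamma_1(\xi))\,w(2^j\gamma_2(\xi)-k)\,e^{2\pi i m_1 2^{-4j}\gamma_1(\xi)}e^{2\pi i m_2 b 2^j\gamma_2(\xi)},$$ $$\widehat{\Psi^\ell_{j,k,m}}(\xi)=2^{-3j/2}\,\widehat\psi_\ell(2^{-4j}\gamma_1(\xi))\,w(2^j\gamma_2(\xi)-k)\,e^{2\pi i m_1 2^{-4j}\gamma_1(\xi)}e^{2\pi i m_2 b 2^j\gamma_2(\xi)}.$$ The scaling space is $V_j=\overline{\mathrm{span}}\{\Phi_{j,k,m}:k\in\mathbb Z,m\in\mathbb Z^2\}$ and the wavelet space is $W_j=\overline{\mathrm{span}}\{\Psi^\ell_{j,k,m}:k\in\mathbb Z,m\in\mathbb Z^2,\ell=1,\dots,15\}$, closed subspaces of $L^2(\mathbb R^2)$. *)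

theory Defs
  imports "HOL-Analysis.Analysis"
begin

section \<open>Square-integrable functions\<close>

text \<open>
  Elements of \<open>L\<^sup>2\<close> are represented by Borel functions; functions that agree almost everywhere
  represent the same element. Every notion below is invariant under a change of representative.
  The inner product is linear in its first argument.
\<close>

definition sq_integrable :: "('a::euclidean_space \<Rightarrow> complex) set" where
  "sq_integrable =
     {f. f \<in> borel_measurable lborel \<and> integrable lborel (\<lambda>x. (cmod (f x))\<^sup>2)}"

definition l2_inner :: "('a::euclidean_space \<Rightarrow> complex) \<Rightarrow> ('a \<Rightarrow> complex) \<Rightarrow> complex" where
  "l2_inner f g = (LINT x|lborel. f x * cnj (g x))"

definition l2_norm :: "('a::euclidean_space \<Rightarrow> complex) \<Rightarrow> real" where
  "l2_norm f = sqrt (LINT x|lborel. (cmod (f x))\<^sup>2)"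

definition closed_span ::
  "('i \<Rightarrow> 'a::euclidean_space \<Rightarrow> complex) \<Rightarrow> 'i set \<Rightarrow> ('a \<Rightarrow> complex) set" where
  "closed_span u I = {f \<in> sq_integrable. \<forall>e>0. \<exists>F c. finite F \<and> F \<subseteq> I \<and>
     l2_norm (\<lambda>x. f x - (\<Sum>i\<in>F. c i * u i x)) < e}"

definition closed_subspace :: "('a::euclidean_space \<Rightarrow> complex) set \<Rightarrow> bool" where
  "closed_subspace S \<longleftrightarrow> S \<subseteq> sq_integrable \<and> (\<lambda>x. 0) \<in> S \<and>
     (\<forall>f\<in>S. \<forall>g\<in>S. (\<lambda>x. f x + g x) \<in> S) \<and>
     (\<forall>c. \<forall>f\<in>S. (\<lambda>x. c * f x) \<in> S) \<and>
     (\<forall>f\<in>sq_integrable. (\<forall>e>0. \<exists>g\<in>S. l2_norm (\<lambda>x. f x - g x) < e) \<longrightarrow> f \<in> S)"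

definition orthonormal_basis ::
  "('i \<Rightarrow> 'a::euclidean_space \<Rightarrow> complex) \<Rightarrow> 'i set \<Rightarrow> ('a \<Rightarrow> complex) set \<Rightarrow> bool" where
  "orthonormal_basis u I H \<longleftrightarrow> (\<forall>i\<in>I. u i \<in> H) \<and>
     (\<forall>i\<in>I. \<forall>i'\<in>I. l2_inner (u i) (u i') = (if i = i' then 1 else 0)) \<and>
     closed_span u I = H"

definition tight_frame ::
  "real \<Rightarrow> ('i \<Rightarrow> 'a::euclidean_space \<Rightarrow> complex) \<Rightarrow> 'i set \<Rightarrow> ('a \<Rightarrow> complex) set \<Rightarrow> bool" where
  "tight_frame a u I H \<longleftrightarrow> (\<forall>i\<in>I. u i \<in> H) \<and>
     (\<forall>f\<in>H. ((\<lambda>i. (cmod (l2_inner f (u i)))\<^sup>2) has_sum a * (l2_norm f)\<^sup>2) I)"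

definition unit_norm_tight_frame ::
  "real \<Rightarrow> ('i \<Rightarrow> 'a::euclidean_space \<Rightarrow> complex) \<Rightarrow> 'i set \<Rightarrow> ('a \<Rightarrow> complex) set \<Rightarrow> bool" where
  "unit_norm_tight_frame a u I H \<longleftrightarrow> tight_frame a u I H \<and> (\<forall>i\<in>I. l2_norm (u i) = 1)"


section \<open>The Fourier transform\<close>

definition fourier_integral :: "('a::euclidean_space \<Rightarrow> complex) \<Rightarrow> 'a \<Rightarrow> complex" where
  "fourier_integral f \<xi> = (LINT x|lborel. f x * cis (- 2 * pi * (x \<bullet> \<xi>)))"

text \<open>
  The extension of the Fourier integral from \<open>L\<^sup>1 \<inter> L\<^sup>2\<close> to \<open>L\<^sup>2\<close> by continuity, as a relation:
  \<open>g\<close> is one of the representatives, determined up to a null set, of the transform of \<open>f\<close>.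
\<close>

definition has_fourier_L2 ::
  "('a::euclidean_space \<Rightarrow> complex) \<Rightarrow> ('a \<Rightarrow> complex) \<Rightarrow> bool" where
  "has_fourier_L2 f g \<longleftrightarrow> f \<in> sq_integrable \<and> g \<in> sq_integrable \<and>
     (\<exists>F :: nat \<Rightarrow> 'a \<Rightarrow> complex.
        (\<forall>n. F n \<in> sq_integrable \<and> integrable lborel (F n) \<and>
             fourier_integral (F n) \<in> sq_integrable) \<and>
        (\<lambda>n. l2_norm (\<lambda>x. F n x - f x)) \<longlonglongrightarrow> 0 \<and>
        (\<lambda>n. l2_norm (\<lambda>\<xi>. fourier_integral (F n) \<xi> - g \<xi>)) \<longlonglongrightarrow> 0)"

definition fourier_L2 :: "('a::euclidean_space \<Rightarrow> complex) \<Rightarrow> 'a \<Rightarrow> complex" where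
  "fourier_L2 f = (SOME g. has_fourier_L2 f g)"

definition inverse_fourier_L2 :: "('a::euclidean_space \<Rightarrow> complex) \<Rightarrow> 'a \<Rightarrow> complex" where
  "inverse_fourier_L2 g = (SOME f. has_fourier_L2 f g)"


section \<open>Multiresolution analyses and Gabor systems\<close>

text \<open>
  \<open>U\<close> is an \<open>M\<close>-band multiresolution analysis of \<open>L\<^sup>2(\<real>)\<close> with orthogonal scaling function \<open>\<phi>\<close>;
  finer scales correspond to larger \<open>j\<close>.
\<close>

definition orthogonal_mra ::
  "nat \<Rightarrow> (int \<Rightarrow> (real \<Rightarrow> complex) set) \<Rightarrow> (real \<Rightarrow> complex) \<Rightarrow> bool" where
  "orthogonal_mra M U \<phi> \<longleftrightarrow>
     (\<forall>j. closed_subspace (U j)) \<and>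
     (\<forall>j. U j \<subseteq> U (j + 1)) \<and>
     (\<forall>j. \<forall>f\<in>sq_integrable. f \<in> U j \<longleftrightarrow> (\<lambda>x. f (real M * x)) \<in> U (j + 1)) \<and>
     (\<forall>f. (\<forall>j. f \<in> U j) \<longrightarrow> (AE x in lborel. f x = 0)) \<and>
     (\<forall>f\<in>sq_integrable. \<forall>e>0. \<exists>j. \<exists>g\<in>U j. l2_norm (\<lambda>x. f x - g x) < e) \<and>
     orthonormal_basis (\<lambda>(k::int) x. \<phi> (x - of_int k)) UNIV (U 0)"

text \<open>
  The integer translates of \<open>\<psi> 1, \<dots>, \<psi> (M - 1)\<close> form an orthonormal basis of the orthogonal
  complement of \<open>U 0\<close> in \<open>U 1\<close>.
\<close>

definition orthonormal_wavelets ::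
  "nat \<Rightarrow> (int \<Rightarrow> (real \<Rightarrow> complex) set) \<Rightarrow> (nat \<Rightarrow> real \<Rightarrow> complex) \<Rightarrow> bool" where
  "orthonormal_wavelets M U \<psi> \<longleftrightarrow>
     orthonormal_basis (\<lambda>(l, k::int) x. \<psi> l (x - of_int k)) ({1..<M} \<times> UNIV)
       {f \<in> U 1. \<forall>g\<in>U 0. l2_inner f g = 0}"

definition gabor :: "real \<Rightarrow> (real \<Rightarrow> complex) \<Rightarrow> int \<times> int \<Rightarrow> real \<Rightarrow> complex" where
  "gabor b w = (\<lambda>(m, k) x. cis (2 * pi * of_int m * b * x) * w (x - of_int k))"


section \<open>The functions on the plane and the spaces they generate\<close>

definition \<gamma>1 :: "real \<times> real \<Rightarrow> real" where
  "\<gamma>1 = (\<lambda>(\<xi>1, \<xi>2). 1/2 * sgn \<xi>1 * \<xi>1\<^sup>2)"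

definition \<gamma>2 :: "real \<times> real \<Rightarrow> real" where
  "\<gamma>2 = (\<lambda>(\<xi>1, \<xi>2). \<xi>2 / \<xi>1)"

text \<open>
  One formula covers both families: \<open>g\<close> is the scaling function or one of the wavelets, and the
  index is \<open>(k, m\<^sub>1, m\<^sub>2)\<close>. The values on the null set \<open>\<xi>\<^sub>1 = 0\<close> are irrelevant.
\<close>

definition atom_hat ::
  "real \<Rightarrow> (real \<Rightarrow> complex) \<Rightarrow> (real \<Rightarrow> complex) \<Rightarrow> int \<Rightarrow> int \<times> int \<times> int \<Rightarrow>
     real \<times> real \<Rightarrow> complex" where
  "atom_hat b w g j = (\<lambda>(k, m1, m2) \<xi>.
     complex_of_real (2 powr (- 3 * of_int j / 2))
     * fourier_L2 g (2 powi (- 4 * j) * \<gamma>1 \<xi>)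
     * w (2 powi j * \<gamma>2 \<xi> - of_int k)
     * cis (2 * pi * of_int m1 * (2 powi (- 4 * j) * \<gamma>1 \<xi>))
     * cis (2 * pi * of_int m2 * b * (2 powi j * \<gamma>2 \<xi>)))"

definition Phi ::
  "real \<Rightarrow> (real \<Rightarrow> complex) \<Rightarrow> (real \<Rightarrow> complex) \<Rightarrow> int \<Rightarrow> int \<times> int \<times> int \<Rightarrow>
     real \<times> real \<Rightarrow> complex" where
  "Phi b w \<phi> j = (\<lambda>(k, m1, m2). inverse_fourier_L2 (atom_hat b w \<phi> j (k, m1, m2)))"

definition Psi ::
  "real \<Rightarrow> (real \<Rightarrow> complex) \<Rightarrow> (nat \<Rightarrow> real \<Rightarrow> complex) \<Rightarrow> int \<Rightarrow> nat \<times> int \<times> int \<times> int \<Rightarrow>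
     real \<times> real \<Rightarrow> complex" where
  "Psi b w \<psi> j = (\<lambda>(l, k, m1, m2). inverse_fourier_L2 (atom_hat b w (\<psi> l) j (k, m1, m2)))"

definition scaling_space ::
  "real \<Rightarrow> (real \<Rightarrow> complex) \<Rightarrow> (real \<Rightarrow> complex) \<Rightarrow> int \<Rightarrow> (real \<times> real \<Rightarrow> complex) set" where
  "scaling_space b w \<phi> j = closed_span (Phi b w \<phi> j) UNIV"

definition wavelet_space ::
  "real \<Rightarrow> (real \<Rightarrow> complex) \<Rightarrow> (nat \<Rightarrow> real \<Rightarrow> complex) \<Rightarrow> int \<Rightarrow> (real \<times> real \<Rightarrow> complex) set" where
  "wavelet_space b w \<psi> j = closed_span (Psi b w \<psi> j) ({1..15} \<times> UNIV)"

end

theory Submission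
  imports Defs "HOL-Probability.Characteristic_Functions"
begin

text \<open>
  The Plancherel theorem and the substitution \<open>(u, v) = (2\<^sup>-\<^sup>4\<^sup>j \<gamma>\<^sub>1, 2\<^sup>j \<gamma>\<^sub>2)\<close>, whose Jacobian is
  constant, carry the atoms isometrically to tensor products of modulated transforms of the
  scaling function (or the wavelets) in \<open>u\<close> with the Gabor functions in \<open>v\<close>. The first factors are
  orthonormal, because modulations are transforms of integer translates. Hence the Gram matrix of the
  atoms is that of an orthonormal system tensored with a \<open>b\<^sup>-\<^sup>1\<close>-tight frame; this gives the
  frame identity on finite linear combinations, and the identity passes to the closed span by
  continuity of the analysis operator.

  Plancherel's theorem is obtained by damping with Gaussians: the transform of the damped inverse
  transform of \<open>g\<close> is a Gaussian average of translates of \<open>g\<close>, which tends to \<open>g\<close> in \<open>L\<^sup>2\<close>.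
\<close>

section \<open>The inner product and norm of square-integrable functions\<close>

text \<open>The transform of an integrable function need not be integrable, so neither Plancherel's
  identity nor inversion can be read off a double integral. The Gaussian factor restores absolute
  convergence, and the same smoothing serves twice: for the isometry and for the density of its
  range. \<open>fourier_L2\<close> and \<open>inverse_fourier_L2\<close> pick arbitrary
  representatives, so the argument works with inner products, on which all choices agree; this is
  why the frame property is derived from a Gram matrix and not from an explicit unitary map. The
  first tensor factors are orthonormal but need not be complete, so the frame identity is sought on
  the closed span; a finite combination meets only finitely many of them. The prefactor 2^(-3j/2)
  has square 2^(-3j) = 2^(-4j) 2^j, while the substitution contributes the reciprocal of that
  product, so the frame bound is that of the Gabor system at every scale.\<close>

lemma sq_integrableD:
  assumes "f \<in> sq_integrable"
  shows "f \<in> borel_measurable borel" "integrable lborel (\<lambda>x. (cmod (f x))\<^sup>2)"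
  using assms by (simp_all add: sq_integrable_def)

lemma nn_integral_sq_eq_l2_norm:
  assumes "f \<in> sq_integrable"
  shows "(\<integral>\<^sup>+x. ennreal ((cmod (f x))\<^sup>2) \<partial>lborel) = ennreal ((l2_norm f)\<^sup>2)"
  using sq_integrableD(2)[OF assms]
  by (subst nn_integral_eq_integral) (auto simp: l2_norm_def integral_nonneg)

lemma l2_norm_nonneg [simp]: "0 \<le> l2_norm f"
  by (simp add: l2_norm_def integral_nonneg)

lemma l2_norm_zero [simp]: "l2_norm (\<lambda>x. 0) = 0"
  by (simp add: l2_norm_def)

lemma sq_integrable_nn_integralI:
  assumes "f \<in> borel_measurable borel"
    and "(\<integral>\<^sup>+x. ennreal ((cmod (f x))\<^sup>2) \<partial>lborel) \<le> ennreal c" "0 \<le> c"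
  shows "f \<in> sq_integrable" "(l2_norm f)\<^sup>2 \<le> c"
proof -
  have [measurable]: "f \<in> borel_measurable borel" by fact
  show f: "f \<in> sq_integrable"
    unfolding sq_integrable_def
    using order.strict_trans1[OF assms(2) ennreal_less_top]
    by (auto simp: integrable_iff_bounded)
  show "(l2_norm f)\<^sup>2 \<le> c"
    using assms(2,3) nn_integral_sq_eq_l2_norm[OF f] by simp
qed

lemma sq_integrable_iff_nn_integral:
  "f \<in> sq_integrable \<longleftrightarrow>
     f \<in> borel_measurable borel \<and> (\<integral>\<^sup>+x. ennreal ((cmod (f x))\<^sup>2) \<partial>lborel) < \<infinity>"
  by (auto simp: sq_integrable_def integrable_iff_bounded)

lemma sq_integrable_scale [intro]:
  assumes "f \<in> sq_integrable" shows "(\<lambda>x. c * f x) \<in> sq_integrable"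
  using assms by (auto simp: sq_integrable_def norm_mult power_mult_distrib)

lemma l2_norm_scale: "l2_norm (\<lambda>x. c * f x) = cmod c * l2_norm f"
  by (simp add: l2_norm_def norm_mult power_mult_distrib real_sqrt_mult)

lemma sq_integrable_cnj [intro]:
  assumes "f \<in> sq_integrable" shows "(\<lambda>x. cnj (f x)) \<in> sq_integrable"
proof -
  note [measurable] = sq_integrableD(1)[OF assms]
  have "(\<lambda>x. cnj (f x)) \<in> borel_measurable borel"
    by (intro borel_measurable_continuous_on[of cnj] continuous_intros) simp
  then show ?thesis using assms by (simp add: sq_integrable_def)
qed

lemma l2_norm_cnj: "l2_norm (\<lambda>x. cnj (f x)) = l2_norm f"
  by (simp add: l2_norm_def)

lemma sq_integrable_zero [simp]: "(\<lambda>x. 0) \<in> sq_integrable"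
  by (simp add: sq_integrable_def)

lemma norm_add_sq_le: "(norm (a + b))\<^sup>2 \<le> 2 * (norm a)\<^sup>2 + 2 * (norm (b :: 'a::real_normed_vector))\<^sup>2"
proof -
  have "(norm (a + b))\<^sup>2 \<le> (norm a + norm b)\<^sup>2"
    by (intro power_mono norm_triangle_ineq) auto
  also have "\<dots> \<le> 2 * (norm a)\<^sup>2 + 2 * (norm b)\<^sup>2"
    using sum_squares_bound[of "norm a" "norm b"] by (simp add: power2_sum)
  finally show ?thesis .
qed

lemma sq_integrable_add [intro]:
  assumes "f \<in> sq_integrable" "g \<in> sq_integrable"
  shows "(\<lambda>x. f x + g x) \<in> sq_integrable"
proof -
  note [measurable] = sq_integrableD(1)[OF assms(1)] sq_integrableD(1)[OF assms(2)]
  have "integrable lborel (\<lambda>x. (cmod (f x + g x))\<^sup>2)"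
  proof (rule Bochner_Integration.integrable_bound)
    show "integrable lborel (\<lambda>x. 2 * (cmod (f x))\<^sup>2 + 2 * (cmod (g x))\<^sup>2)"
      using assms[THEN sq_integrableD(2)] by simp
  qed (auto intro!: AE_I2 norm_add_sq_le)
  then show ?thesis by (simp add: sq_integrable_def)
qed

lemma sq_integrable_diff [intro]:
  assumes "f \<in> sq_integrable" "g \<in> sq_integrable"
  shows "(\<lambda>x. f x - g x) \<in> sq_integrable"
  using sq_integrable_add[OF assms(1) sq_integrable_scale[OF assms(2), of "-1"]] by simp

lemma sq_integrable_sum [intro]:
  assumes "\<And>i. i \<in> F \<Longrightarrow> u i \<in> sq_integrable"
  shows "(\<lambda>x. \<Sum>i\<in>F. u i x) \<in> sq_integrable"
  using assms by (induction F rule: infinite_finite_induct) auto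

lemma l2_norm_minus_commute: "l2_norm (\<lambda>x. f x - g x) = l2_norm (\<lambda>x. g x - f x)"
  by (simp add: l2_norm_def norm_minus_commute)

lemma sq_integrable_integrable_mult:
  assumes "f \<in> sq_integrable" "g \<in> sq_integrable"
  shows "integrable lborel (\<lambda>x. f x * g x)"
proof (rule Bochner_Integration.integrable_bound)
  note [measurable] = sq_integrableD(1)[OF assms(1)] sq_integrableD(1)[OF assms(2)]
  show "integrable lborel (\<lambda>x. (cmod (f x))\<^sup>2 + (cmod (g x))\<^sup>2)"
    using assms[THEN sq_integrableD(2)] by simp
  show "(\<lambda>x. f x * g x) \<in> borel_measurable lborel" by simp
  have "a * b \<le> a\<^sup>2 + b\<^sup>2" if "0 \<le> a" "0 \<le> b" for a b :: real
    using sum_squares_bound[of a b] mult_nonneg_nonneg[OF that] by linarith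
  then show "AE x in lborel. cmod (f x * g x) \<le> norm ((cmod (f x))\<^sup>2 + (cmod (g x))\<^sup>2)"
    by (auto simp: norm_mult)
qed

lemma l2_inner_integrable:
  assumes "f \<in> sq_integrable" "g \<in> sq_integrable"
  shows "integrable lborel (\<lambda>x. f x * cnj (g x))"
  using sq_integrable_integrable_mult[OF assms(1) sq_integrable_cnj[OF assms(2)]] .

lemma nn_integral_mult_le_l2:
  assumes "f \<in> sq_integrable" "g \<in> sq_integrable"
  shows "(\<integral>\<^sup>+x. ennreal (cmod (f x) * cmod (g x)) \<partial>lborel) \<le> ennreal (l2_norm f * l2_norm g)"
proof -
  note [measurable] = sq_integrableD(1)[OF assms(1)] sq_integrableD(1)[OF assms(2)]
  let ?I = "\<integral>\<^sup>+x. ennreal (cmod (f x)) * ennreal (cmod (g x)) \<partial>lborel"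
  have "?I\<^sup>2 \<le> (\<integral>\<^sup>+x. (ennreal (cmod (f x)))\<^sup>2 \<partial>lborel) * (\<integral>\<^sup>+x. (ennreal (cmod (g x)))\<^sup>2 \<partial>lborel)"
    by (rule Cauchy_Schwarz_nn_integral) auto
  also have "\<dots> = ennreal ((l2_norm f * l2_norm g)\<^sup>2)"
    using assms[THEN nn_integral_sq_eq_l2_norm]
    by (simp add: ennreal_power ennreal_mult power_mult_distrib)
  finally have *: "?I\<^sup>2 \<le> (ennreal (l2_norm f * l2_norm g))\<^sup>2"
    by (simp add: ennreal_power)
  have "?I \<le> ennreal (l2_norm f * l2_norm g)"
  proof (cases ?I)
    case (real r)
    with * have "r\<^sup>2 \<le> (l2_norm f * l2_norm g)\<^sup>2"
      by (simp add: ennreal_power)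
    then have "r \<le> l2_norm f * l2_norm g"
      by (rule power2_le_imp_le) simp
    with real show ?thesis by (simp add: ennreal_leI)
  \<comment> \<open>An infinite integral would have infinite square, against the finite bound just
    obtained.\<close>
  next
    case top
    with * have "(top::ennreal)\<^sup>2 \<le> ennreal ((l2_norm f * l2_norm g)\<^sup>2)"
      by (simp add: ennreal_power)
    then show ?thesis by (simp add: power2_eq_square top_unique del: ennreal_mult)
  qed
  then show ?thesis by (simp add: ennreal_mult)
qed

lemma norm_integral_mult_le_l2:
  assumes "f \<in> sq_integrable" "g \<in> sq_integrable"
  shows "cmod (LINT x|lborel. f x * g x) \<le> l2_norm f * l2_norm g"
proof -
  have "ennreal (cmod (LINT x|lborel. f x * g x)) \<le> (\<integral>\<^sup>+x. ennreal (cmod (f x * g x)) \<partial>lborel)"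
    using sq_integrable_integrable_mult[OF assms] by (rule integral_norm_bound_ennreal)
  also have "\<dots> \<le> ennreal (l2_norm f * l2_norm g)"
    using nn_integral_mult_le_l2[OF assms] by (simp add: norm_mult)
  finally show ?thesis by (simp add: ennreal_le_iff)
qed

lemma l2_Cauchy_Schwarz:
  assumes "f \<in> sq_integrable" "g \<in> sq_integrable"
  shows "cmod (l2_inner f g) \<le> l2_norm f * l2_norm g"
  using norm_integral_mult_le_l2[OF assms(1) sq_integrable_cnj[OF assms(2)]]
  by (simp add: l2_inner_def l2_norm_cnj)

lemma l2_inner_self: "l2_inner f f = of_real ((l2_norm f)\<^sup>2)"
  by (simp add: l2_inner_def l2_norm_def complex_norm_square[symmetric] integral_nonneg
      del: of_real_power flip: integral_complex_of_real)

lemma l2_inner_add_left: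
  assumes "f \<in> sq_integrable" "g \<in> sq_integrable" "h \<in> sq_integrable"
  shows "l2_inner (\<lambda>x. f x + g x) h = l2_inner f h + l2_inner g h"
  using assms by (simp add: l2_inner_def distrib_right l2_inner_integrable)

lemma l2_inner_scale_left: "l2_inner (\<lambda>x. c * f x) h = c * l2_inner f h"
  by (simp add: l2_inner_def mult.assoc)

lemma l2_inner_commute: "l2_inner g f = cnj (l2_inner f g)"
proof -
  have "cnj (l2_inner f g) = (LINT x|lborel. cnj (f x * cnj (g x)))"
    unfolding l2_inner_def by (rule Bochner_Integration.integral_cnj[symmetric])
  then show ?thesis by (simp add: l2_inner_def mult.commute)
qed

lemma l2_inner_diff_left:
  assumes "f \<in> sq_integrable" "g \<in> sq_integrable" "h \<in> sq_integrable"
  shows "l2_inner (\<lambda>x. f x - g x) h = l2_inner f h - l2_inner g h"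
  using assms by (simp add: l2_inner_def left_diff_distrib l2_inner_integrable)

lemma l2_inner_sum_left:
  assumes "\<And>i. i \<in> F \<Longrightarrow> u i \<in> sq_integrable" "h \<in> sq_integrable"
  shows "l2_inner (\<lambda>x. \<Sum>i\<in>F. c i * u i x) h = (\<Sum>i\<in>F. c i * l2_inner (u i) h)"
  using assms
proof (induction F rule: infinite_finite_induct)
  case (insert i F)
  then show ?case
    by (simp add: l2_inner_add_left l2_inner_scale_left sq_integrable_scale sq_integrable_sum)
qed (simp_all add: l2_inner_def)

lemma l2_inner_sum_right:
  assumes "\<And>i. i \<in> F \<Longrightarrow> u i \<in> sq_integrable" "h \<in> sq_integrable"
  shows "l2_inner h (\<lambda>x. \<Sum>i\<in>F. c i * u i x) = (\<Sum>i\<in>F. cnj (c i) * l2_inner h (u i))"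
  by (subst l2_inner_commute) (simp add: l2_inner_sum_left assms flip: l2_inner_commute)

lemma l2_norm_sq_add:
  assumes "f \<in> sq_integrable" "g \<in> sq_integrable"
  shows "(l2_norm (\<lambda>x. f x + g x))\<^sup>2 = (l2_norm f)\<^sup>2 + (l2_norm g)\<^sup>2 + 2 * Re (l2_inner f g)"
proof -
  have "of_real ((l2_norm (\<lambda>x. f x + g x))\<^sup>2) = l2_inner (\<lambda>x. f x + g x) (\<lambda>x. f x + g x)"
    by (simp only: l2_inner_self)
  also have "\<dots> = l2_inner f (\<lambda>x. f x + g x) + l2_inner g (\<lambda>x. f x + g x)"
    using assms by (intro l2_inner_add_left) auto
  also have "\<dots> = cnj (l2_inner (\<lambda>x. f x + g x) f) + cnj (l2_inner (\<lambda>x. f x + g x) g)"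
    by (simp flip: l2_inner_commute)
  also have "\<dots> = of_real ((l2_norm f)\<^sup>2) + of_real ((l2_norm g)\<^sup>2) + (l2_inner f g + cnj (l2_inner f g))"
    using assms by (simp add: l2_inner_add_left l2_inner_self del: of_real_power flip: l2_inner_commute)
  finally have "Re (of_real ((l2_norm (\<lambda>x. f x + g x))\<^sup>2)) = Re \<dots>" by simp
  then show ?thesis by simp
qed

lemma l2_norm_triangle:
  assumes "f \<in> sq_integrable" "g \<in> sq_integrable"
  shows "l2_norm (\<lambda>x. f x + g x) \<le> l2_norm f + l2_norm g"
proof (rule power2_le_imp_le)
  have "Re (l2_inner f g) \<le> l2_norm f * l2_norm g"
    using l2_Cauchy_Schwarz[OF assms] complex_Re_le_cmod order_trans by blast
  then show "(l2_norm (\<lambda>x. f x + g x))\<^sup>2 \<le> (l2_norm f + l2_norm g)\<^sup>2"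
    using l2_norm_sq_add[OF assms] by (simp add: power2_sum)
qed simp

lemma l2_norm_triangle_diff:
  assumes "f \<in> sq_integrable" "g \<in> sq_integrable" "h \<in> sq_integrable"
  shows "l2_norm (\<lambda>x. f x - h x) \<le> l2_norm (\<lambda>x. f x - g x) + l2_norm (\<lambda>x. g x - h x)"
  using l2_norm_triangle[of "\<lambda>x. f x - g x" "\<lambda>x. g x - h x"] assms by auto

lemma l2_norm_diff_abs:
  assumes "f \<in> sq_integrable" "g \<in> sq_integrable"
  shows "\<bar>l2_norm f - l2_norm g\<bar> \<le> l2_norm (\<lambda>x. f x - g x)"
  using l2_norm_triangle[OF assms(2) sq_integrable_diff[OF assms]]
    l2_norm_triangle[OF assms(1) sq_integrable_diff[OF assms(2,1)]]
    l2_norm_minus_commute[of f g] by simp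

lemma tendsto_l2_norm:
  assumes "\<And>n. F n \<in> sq_integrable" "f \<in> sq_integrable"
    and "((\<lambda>n. l2_norm (\<lambda>x. F n x - f x)) \<longlongrightarrow> 0) net"
  shows "((\<lambda>n. l2_norm (F n)) \<longlongrightarrow> l2_norm f) net"
proof (rule LIM_zero_cancel, rule Lim_null_comparison[OF _ assms(3)])
  show "\<forall>\<^sub>F n in net. norm (l2_norm (F n) - l2_norm f) \<le> l2_norm (\<lambda>x. F n x - f x)"
    using l2_norm_diff_abs[OF assms(1,2)] by (intro always_eventually) simp
qed

text \<open>Polarization: c = 1 recovers the real part and c = \<i> the imaginary part. The two
  pairs may live on different spaces.\<close>

lemma l2_inner_eqI:
  assumes "f \<in> sq_integrable" "g \<in> sq_integrable" "f' \<in> sq_integrable" "g' \<in> sq_integrable"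
    and "\<And>c. l2_norm (\<lambda>x. f x + c * g x) = l2_norm (\<lambda>x. f' x + c * g' x)"
    and "l2_norm f = l2_norm f'" "l2_norm g = l2_norm g'"
  shows "l2_inner f g = l2_inner f' g'"
proof -
  have *: "Re (cnj c * l2_inner f g) = Re (cnj c * l2_inner f' g')" for c
  proof -
    have e: "l2_inner p (\<lambda>x. c * q x) = cnj c * l2_inner p q" for p q :: "'d::euclidean_space \<Rightarrow> complex"
      by (subst l2_inner_commute) (simp add: l2_inner_scale_left flip: l2_inner_commute)
    show ?thesis
      using l2_norm_sq_add[OF assms(1) sq_integrable_scale[OF assms(2), of c]]
        l2_norm_sq_add[OF assms(3) sq_integrable_scale[OF assms(4), of c]] assms(5)[of c] assms(6,7)
      by (simp add: e l2_norm_scale)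
  qed
  from *[of 1] *[of \<i>] show ?thesis by (simp add: complex_eq_iff)
qed


section \<open>Completeness\<close>

text \<open>Along a rapidly Cauchy subsequence \<open>G\<close>, the weighted sum \<open>\<Sum>k. 2\<^sup>k \<bar>G (k+1) - G k\<bar>\<^sup>2\<close> is
  integrable, hence finite almost everywhere, which makes the increments absolutely summable.\<close>

lemma l2_complete:
  fixes F :: "nat \<Rightarrow> 'a::euclidean_space \<Rightarrow> complex"
  assumes F: "\<And>n. F n \<in> sq_integrable"
    and Cauchy: "\<And>e. e > 0 \<Longrightarrow> \<exists>N. \<forall>m\<ge>N. \<forall>n\<ge>N. l2_norm (\<lambda>x. F m x - F n x) < e"
  shows "\<exists>f\<in>sq_integrable. (\<lambda>n. l2_norm (\<lambda>x. F n x - f x)) \<longlonglongrightarrow> 0"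
proof -
  have [measurable]: "F n \<in> borel_measurable borel" for n by (rule sq_integrableD(1)[OF F])
  have "\<forall>k. \<exists>N. \<forall>m\<ge>N. \<forall>n\<ge>N. l2_norm (\<lambda>x. F m x - F n x) < (1/2) ^ k"
    using Cauchy by simp
  then obtain N where N: "\<And>k m n. m \<ge> N k \<Longrightarrow> n \<ge> N k \<Longrightarrow> l2_norm (\<lambda>x. F m x - F n x) < (1/2) ^ k"
    by metis
  \<comment> \<open>The sum makes \<open>r\<close> monotone and at least \<open>N k\<close>; the
    summand k makes it tend to infinity.\<close>
  define r where "r k = k + (\<Sum>i\<le>k. N i)" for k
  have rN: "r k \<ge> N k" for k
    unfolding r_def using member_le_sum[of k "{..k}" N] by simp
  have rk: "r k \<ge> k" for k by (simp add: r_def)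
  have r_Suc: "r (Suc k) \<ge> r k" for k by (simp add: r_def)
  define G where "G k = F (r k)" for k
  have [measurable]: "G k \<in> borel_measurable borel" for k by (simp add: G_def)
  have D: "(\<lambda>x. G (Suc k) x - G k x) \<in> sq_integrable" for k
    unfolding G_def using F by (intro sq_integrable_diff)
  have G: "l2_norm (\<lambda>x. G (Suc k) x - G k x) < (1/2) ^ k" for k
    unfolding G_def using rN r_Suc order_trans by (intro N) blast+
  have "(\<integral>\<^sup>+x. (\<Sum>k. ennreal (2 ^ k * (cmod (G (Suc k) x - G k x))\<^sup>2)) \<partial>lborel)
      = (\<Sum>k. \<integral>\<^sup>+x. ennreal (2 ^ k * (cmod (G (Suc k) x - G k x))\<^sup>2) \<partial>lborel)"
    by (rule nn_integral_suminf) measurable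
  \<comment> \<open>The squared norm of the k-th increment is below 4^(-k), and the weight 2^k
    leaves 2^(-k).\<close>
  also have "\<dots> \<le> (\<Sum>k. ennreal ((1/2) ^ k))"
  proof (intro suminf_le summableI allI)
    fix k
    have "(\<integral>\<^sup>+x. ennreal (2 ^ k * (cmod (G (Suc k) x - G k x))\<^sup>2) \<partial>lborel)
        = ennreal (2 ^ k * (l2_norm (\<lambda>x. G (Suc k) x - G k x))\<^sup>2)"
      using nn_integral_sq_eq_l2_norm[OF D, of k] by (simp add: ennreal_mult nn_integral_cmult)
    also have "\<dots> \<le> ennreal (2 ^ k * ((1/2) ^ k)\<^sup>2)"
      using G[of k] by (intro ennreal_leI mult_left_mono power_mono) auto
    also have "2 ^ k * ((1/2) ^ k)\<^sup>2 = ((1/2) ^ k :: real)"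
      by (simp add: power2_eq_square power_divide)
    finally show "(\<integral>\<^sup>+x. ennreal (2 ^ k * (cmod (G (Suc k) x - G k x))\<^sup>2) \<partial>lborel) \<le> ennreal ((1/2) ^ k)" .
  qed
  also have "\<dots> = ennreal (\<Sum>k. (1/2) ^ k)"
    by (intro suminf_ennreal2) (auto simp: summable_geometric)
  also have "\<dots> < \<infinity>" by simp
  finally have fin: "(\<integral>\<^sup>+x. (\<Sum>k. ennreal (2 ^ k * (cmod (G (Suc k) x - G k x))\<^sup>2)) \<partial>lborel) \<noteq> \<infinity>" by simp
  have "AE x in lborel. (\<Sum>k. ennreal (2 ^ k * (cmod (G (Suc k) x - G k x))\<^sup>2)) \<noteq> \<infinity>"
    by (rule nn_integral_PInf_AE[OF _ fin]) measurable
  then have conv: "AE x in lborel. convergent (\<lambda>k. G k x)"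
  proof eventually_elim
    case (elim x)
    let ?d = "\<lambda>k. cmod (G (Suc k) x - G k x)"
    have "summable (\<lambda>k. 2 ^ k * (?d k)\<^sup>2)"
      using elim by (intro summable_suminf_not_top) auto
    then have "(\<lambda>k. 2 ^ k * (?d k)\<^sup>2) \<longlonglongrightarrow> 0" by (rule summable_LIMSEQ_zero)
    then obtain K where K: "\<And>k. k \<ge> K \<Longrightarrow> 2 ^ k * (?d k)\<^sup>2 < 1"
      using LIMSEQ_D[of _ 0 1] by fastforce
    \<comment> \<open>Weighted squares below 1 give increments below 2^(-k/2), again a geometric
      series.\<close>
    have le: "norm (G (Suc k) x - G k x) \<le> (1 / sqrt 2) ^ k" if "k \<ge> K" for k
    proof (rule power2_le_imp_le)
      have "((1 / sqrt 2) ^ k)\<^sup>2 = ((1 / sqrt 2)\<^sup>2) ^ k" by (simp only: power_mult[symmetric] mult.commute)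
      also have "\<dots> = 1 / 2 ^ k" by (simp add: power_divide)
      finally show "(?d k)\<^sup>2 \<le> ((1 / sqrt 2) ^ k)\<^sup>2" using K[OF that] by (simp add: field_simps)
    qed simp
    have "summable (\<lambda>k. (1 / sqrt 2) ^ k :: real)" by (rule summable_geometric) simp
    then have "summable (\<lambda>k. G (Suc k) x - G k x)"
      by (rule summable_comparison_test'[OF _ le])
    then have "convergent (\<lambda>n. \<Sum>k<n. G (Suc k) x - G k x)" by (simp add: summable_iff_convergent)
    then have "convergent (\<lambda>n. (G n x - G 0 x) + G 0 x)"
      by (intro convergent_add convergent_const) (simp add: sum_lessThan_telescope[of "\<lambda>k. G k x"])
    then show ?case by simp
  qed
  define f where "f x = lim (\<lambda>k. G k x)" for x
  have [measurable]: "f \<in> borel_measurable borel" unfolding f_def[abs_def] by measurable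
  have lim: "AE x in lborel. (\<lambda>k. G k x) \<longlonglongrightarrow> f x"
    using conv by eventually_elim (simp add: f_def convergent_LIMSEQ_iff)
  \<comment> \<open>Fatou's lemma along \<open>G\<close>. Membership of the difference comes first;
    that of \<open>f\<close> itself is deduced from it.\<close>
  have bound: "(\<lambda>x. F n x - f x) \<in> sq_integrable \<and> (l2_norm (\<lambda>x. F n x - f x))\<^sup>2 \<le> e\<^sup>2"
    if e: "e > 0" and n: "\<And>m. m \<ge> n \<Longrightarrow> l2_norm (\<lambda>x. F n x - F m x) < e" for e n
  proof -
    have "(\<integral>\<^sup>+x. ennreal ((cmod (F n x - f x))\<^sup>2) \<partial>lborel)
        = (\<integral>\<^sup>+x. liminf (\<lambda>k. ennreal ((cmod (F n x - G k x))\<^sup>2)) \<partial>lborel)"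
      using lim
    proof (intro nn_integral_cong_AE, eventually_elim)
      case (elim x)
      have "(\<lambda>k. ennreal ((cmod (F n x - G k x))\<^sup>2)) \<longlonglongrightarrow> ennreal ((cmod (F n x - f x))\<^sup>2)"
        by (intro tendsto_intros elim)
      then show ?case
        by (rule lim_imp_Liminf[OF trivial_limit_sequentially, symmetric])
    qed
    also have "\<dots> \<le> liminf (\<lambda>k. \<integral>\<^sup>+x. ennreal ((cmod (F n x - G k x))\<^sup>2) \<partial>lborel)"
      by (rule nn_integral_liminf) measurable
    also have "\<dots> \<le> ennreal (e\<^sup>2)"
    proof (rule Liminf_le)
      show "\<forall>\<^sub>F k in sequentially. (\<integral>\<^sup>+x. ennreal ((cmod (F n x - G k x))\<^sup>2) \<partial>lborel) \<le> ennreal (e\<^sup>2)"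
        unfolding eventually_sequentially
      proof (intro exI allI impI)
        fix k assume "n \<le> k"
        then have "l2_norm (\<lambda>x. F n x - G k x) < e"
          unfolding G_def using rk[of k] by (intro n) simp
        then have "(l2_norm (\<lambda>x. F n x - G k x))\<^sup>2 \<le> e\<^sup>2"
          by (intro power_mono) auto
        then show "(\<integral>\<^sup>+x. ennreal ((cmod (F n x - G k x))\<^sup>2) \<partial>lborel) \<le> ennreal (e\<^sup>2)"
          using nn_integral_sq_eq_l2_norm[of "\<lambda>x. F n x - G k x"] F by (simp add: G_def sq_integrable_diff ennreal_leI)
      qed
    qed simp
    finally show ?thesis
      using sq_integrable_nn_integralI[of "\<lambda>x. F n x - f x" "e\<^sup>2"] by auto
  qed
  show ?thesis
  proof (rule bexI[of _ f])
    obtain n where "\<And>m. m \<ge> n \<Longrightarrow> l2_norm (\<lambda>x. F n x - F m x) < 1"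
      using Cauchy[of 1] by force
    from bound[OF zero_less_one this] have "(\<lambda>x. F n x - f x) \<in> sq_integrable" by simp
    from sq_integrable_diff[OF F[of n] this] show "f \<in> sq_integrable" by simp
    show "(\<lambda>n. l2_norm (\<lambda>x. F n x - f x)) \<longlonglongrightarrow> 0"
    proof (rule LIMSEQ_I)
      fix e :: real assume e: "e > 0"
      then obtain M where M: "\<And>m n. m \<ge> M \<Longrightarrow> n \<ge> M \<Longrightarrow> l2_norm (\<lambda>x. F m x - F n x) < e / 2"
        using Cauchy[of "e / 2"] by force
      have "l2_norm (\<lambda>x. F n x - f x) < e" if n: "n \<ge> M" for n
      proof -
        have "(l2_norm (\<lambda>x. F n x - f x))\<^sup>2 \<le> (e / 2)\<^sup>2"
          using bound[of "e / 2" n] e M n by force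
        then have "l2_norm (\<lambda>x. F n x - f x) \<le> e / 2"
          by (rule power2_le_imp_le) (use e in simp)
        then show ?thesis using e by simp
      qed
      then show "\<exists>no. \<forall>n\<ge>no. norm (l2_norm (\<lambda>x. F n x - f x) - 0) < e" by auto
    qed
  qed
qed


section \<open>Continuity of translations\<close>

text \<open>The limit itself dominates: the squared error is at most (C + 1)^2 times the squared
  modulus of \<open>f\<close>. It serves simple functions with C = 2 and truncations to balls with C
  = 1.\<close>

lemma l2_dominated_convergence:
  fixes F :: "nat \<Rightarrow> 'a::euclidean_space \<Rightarrow> complex"
  assumes f: "f \<in> sq_integrable" and F: "\<And>n. F n \<in> borel_measurable borel"
    and bound: "\<And>n x. cmod (F n x) \<le> C * cmod (f x)"
    and lim: "\<And>x. (\<lambda>n. F n x) \<longlonglongrightarrow> f x"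
  shows "F n \<in> sq_integrable" and "(\<lambda>n. l2_norm (\<lambda>x. F n x - f x)) \<longlonglongrightarrow> 0"
proof -
  note [measurable] = F sq_integrableD(1)[OF f]
  have "integrable lborel (\<lambda>x. (cmod (F n x))\<^sup>2)"
  proof (rule Bochner_Integration.integrable_bound)
    show "integrable lborel (\<lambda>x. C\<^sup>2 * (cmod (f x))\<^sup>2)"
      using sq_integrableD(2)[OF f] by simp
    show "AE x in lborel. norm ((cmod (F n x))\<^sup>2) \<le> norm (C\<^sup>2 * (cmod (f x))\<^sup>2)"
      using power_mono[OF bound, of n _ 2] by (auto simp: power_mult_distrib)
  qed simp
  then show "F n \<in> sq_integrable" by (simp add: sq_integrable_def)
  have "(\<lambda>n. LINT x|lborel. (cmod (F n x - f x))\<^sup>2) \<longlonglongrightarrow> (LINT x|(lborel :: 'a measure). 0)"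
  proof (rule integral_dominated_convergence[where w="\<lambda>x. (C + 1)\<^sup>2 * (cmod (f x))\<^sup>2"])
    show "integrable lborel (\<lambda>x. (C + 1)\<^sup>2 * (cmod (f x))\<^sup>2)"
      using sq_integrableD(2)[OF f] by simp
    show "AE x in lborel. (\<lambda>n. (cmod (F n x - f x))\<^sup>2) \<longlonglongrightarrow> 0"
    proof (rule AE_I2)
      fix x
      have "(\<lambda>n. (cmod (F n x - f x))\<^sup>2) \<longlonglongrightarrow> (cmod (f x - f x))\<^sup>2"
        by (intro tendsto_intros lim)
      then show "(\<lambda>n. (cmod (F n x - f x))\<^sup>2) \<longlonglongrightarrow> 0" by simp
    qed
    fix n
    show "AE x in lborel. norm ((cmod (F n x - f x))\<^sup>2) \<le> (C + 1)\<^sup>2 * (cmod (f x))\<^sup>2"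
    proof (rule AE_I2)
      fix x
      have "cmod (F n x - f x) \<le> (C + 1) * cmod (f x)"
        using norm_triangle_ineq4[of "F n x" "f x"] bound[of n x] by (simp add: algebra_simps)
      from power_mono[OF this, of 2]
      show "norm ((cmod (F n x - f x))\<^sup>2) \<le> (C + 1)\<^sup>2 * (cmod (f x))\<^sup>2"
        by (simp add: power_mult_distrib)
    qed
  qed auto
  from tendsto_real_sqrt[OF this]
  show "(\<lambda>n. l2_norm (\<lambda>x. F n x - f x)) \<longlonglongrightarrow> 0"
    by (simp add: l2_norm_def)
qed

section \<open>Translation operators\<close>

lemma nn_integral_translate:
  fixes h :: "'a::euclidean_space"
  assumes "f \<in> borel_measurable borel"
  shows "(\<integral>\<^sup>+x. f (x + h) \<partial>lborel) = (\<integral>\<^sup>+x. f x \<partial>lborel)"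
proof -
  have "(\<integral>\<^sup>+x. f x \<partial>distr lborel borel ((+) h)) = (\<integral>\<^sup>+x. f (h + x) \<partial>lborel)"
    using assms by (intro nn_integral_distr) auto
  then show ?thesis by (simp add: lborel_distr_plus add.commute)
qed

lemma sq_integrable_translate [intro]:
  assumes "f \<in> sq_integrable" shows "(\<lambda>x. f (x + h)) \<in> sq_integrable"
proof -
  note [measurable] = sq_integrableD(1)[OF assms]
  show ?thesis
    using assms nn_integral_translate[of "\<lambda>x. ennreal ((cmod (f x))\<^sup>2)" h]
    by (auto simp: sq_integrable_iff_nn_integral)
qed

lemma integral_translate:
  fixes f :: "'a::euclidean_space \<Rightarrow> 'b::{banach, second_countable_topology}"
  assumes "f \<in> borel_measurable borel"
  shows "(LINT x|lborel. f (x + h)) = (LINT x|lborel. f x)"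
proof -
  have "(LINT x|distr lborel borel ((+) h). f x) = (LINT x|lborel. f (h + x))"
    using assms by (intro integral_distr) auto
  then show ?thesis by (simp add: lborel_distr_plus add.commute)
qed

lemma l2_norm_translate:
  assumes "f \<in> borel_measurable borel" shows "l2_norm (\<lambda>x. f (x + h)) = l2_norm f"
  unfolding l2_norm_def using assms integral_translate[of "\<lambda>x. (cmod (f x))\<^sup>2" h] by simp

text \<open>The sequential form lets dominated convergence apply directly, and the built-in
  membership makes the predicate stable under sums and multiples without side conditions.\<close>

definition translation_continuous :: "('a::euclidean_space \<Rightarrow> complex) \<Rightarrow> bool" where
  "translation_continuous f \<longleftrightarrow> f \<in> sq_integrable \<and>
     (\<forall>h :: nat \<Rightarrow> 'a. h \<longlonglongrightarrow> 0 \<longrightarrow> (\<lambda>n. l2_norm (\<lambda>x. f (x + h n) - f x)) \<longlonglongrightarrow> 0)"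

lemma translation_continuous_add:
  assumes "translation_continuous f" "translation_continuous g"
  shows "translation_continuous (\<lambda>x. f x + g x)"
proof -
  have L: "f \<in> sq_integrable" "g \<in> sq_integrable"
    using assms by (auto simp: translation_continuous_def)
  have "(\<lambda>n. l2_norm (\<lambda>x. f (x + h n) + g (x + h n) - (f x + g x))) \<longlonglongrightarrow> 0"
    if "h \<longlonglongrightarrow> 0" for h :: "nat \<Rightarrow> 'a"
  proof (rule Lim_null_comparison)
    show "(\<lambda>n. l2_norm (\<lambda>x. f (x + h n) - f x) + l2_norm (\<lambda>x. g (x + h n) - g x)) \<longlonglongrightarrow> 0"
      using assms that by (intro tendsto_add_zero) (auto simp: translation_continuous_def)
    have "l2_norm (\<lambda>x. (f (x + h n) - f x) + (g (x + h n) - g x))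
        \<le> l2_norm (\<lambda>x. f (x + h n) - f x) + l2_norm (\<lambda>x. g (x + h n) - g x)" for n
      using L by (intro l2_norm_triangle sq_integrable_diff sq_integrable_translate)
    then show "\<forall>\<^sub>F n in sequentially. norm (l2_norm (\<lambda>x. f (x + h n) + g (x + h n) - (f x + g x)))
        \<le> l2_norm (\<lambda>x. f (x + h n) - f x) + l2_norm (\<lambda>x. g (x + h n) - g x)"
      by (intro always_eventually) (simp add: algebra_simps)
  qed
  then show ?thesis using L by (auto simp: translation_continuous_def)
qed

lemma translation_continuous_scale:
  assumes "translation_continuous f" shows "translation_continuous (\<lambda>x. c * f x)"
  using assms tendsto_mult_right_zero[of _ _ "cmod c"]
  by (auto simp: translation_continuous_def l2_norm_scale simp flip: right_diff_distrib)

lemma translation_continuous_zero: "translation_continuous (\<lambda>x. 0)"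
  by (simp add: translation_continuous_def)

lemma translation_continuous_sum:
  assumes "\<And>i. i \<in> I \<Longrightarrow> translation_continuous (f i)"
  shows "translation_continuous (\<lambda>x. \<Sum>i\<in>I. f i x)"
  using assms
  by (induction I rule: infinite_finite_induct)
    (simp_all add: translation_continuous_zero translation_continuous_add)

text \<open>Translations are isometries, so the error of replacing \<open>f\<close> by
  \<open>g\<close> is the same before and after the shift, uniformly in the shift.\<close>

lemma translation_continuous_lim:
  assumes f: "f \<in> sq_integrable"
    and approx: "\<And>e. e > 0 \<Longrightarrow> \<exists>g. translation_continuous g \<and> l2_norm (\<lambda>x. f x - g x) < e"
  shows "translation_continuous f"
  unfolding translation_continuous_def
proof (intro conjI allI impI f)
  fix h :: "nat \<Rightarrow> 'a" assume h: "h \<longlonglongrightarrow> 0"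
  show "(\<lambda>n. l2_norm (\<lambda>x. f (x + h n) - f x)) \<longlonglongrightarrow> 0"
  proof (rule LIMSEQ_I)
    fix e :: real assume e: "e > 0"
    then obtain g where g: "translation_continuous g" "l2_norm (\<lambda>x. f x - g x) < e / 3"
      using approx[of "e / 3"] by auto
    have gL: "g \<in> sq_integrable" using g by (simp add: translation_continuous_def)
    have "(\<lambda>n. l2_norm (\<lambda>x. g (x + h n) - g x)) \<longlonglongrightarrow> 0"
      using g h by (simp add: translation_continuous_def)
    then obtain N where N: "\<And>n. n \<ge> N \<Longrightarrow> l2_norm (\<lambda>x. g (x + h n) - g x) < e / 3"
      using LIMSEQ_D[of _ 0 "e / 3"] e by fastforce
    have "l2_norm (\<lambda>x. f (x + h n) - f x) < e" if "n \<ge> N" for n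
    proof -
      have "l2_norm (\<lambda>x. f (x + h n) - f x)
          \<le> l2_norm (\<lambda>x. f (x + h n) - g (x + h n)) + l2_norm (\<lambda>x. g (x + h n) - f x)"
        using f gL by (intro l2_norm_triangle_diff sq_integrable_translate)
      also have "l2_norm (\<lambda>x. g (x + h n) - f x)
          \<le> l2_norm (\<lambda>x. g (x + h n) - g x) + l2_norm (\<lambda>x. g x - f x)"
        using f gL by (intro l2_norm_triangle_diff sq_integrable_translate)
      also have "l2_norm (\<lambda>x. f (x + h n) - g (x + h n)) = l2_norm (\<lambda>x. f x - g x)"
        using sq_integrableD(1)[OF sq_integrable_diff[OF f gL]]
        by (rule l2_norm_translate[where f="\<lambda>x. f x - g x"])
      finally show ?thesis
        using g(2) N[OF that] l2_norm_minus_commute[of g f] by simp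
    qed
    then show "\<exists>N. \<forall>n\<ge>N. norm (l2_norm (\<lambda>x. f (x + h n) - f x) - 0) < e" by auto
  qed
qed

section \<open>Continuity of translations, from open sets to all square-integrable functions\<close>

lemma sq_integrable_indicator:
  assumes "A \<in> sets borel" "emeasure lborel A < \<infinity>"
  shows "(\<lambda>x. indicator A x) \<in> sq_integrable"
    and "(l2_norm (\<lambda>x. indicator A x))\<^sup>2 = measure lborel A"
proof -
  have *: "(cmod (indicator A x))\<^sup>2 = indicator A x" for x
    by (simp split: split_indicator)
  show "(\<lambda>x. indicator A x) \<in> sq_integrable"
    using assms by (simp add: sq_integrable_def *)
  show "(l2_norm (\<lambda>x. indicator A x))\<^sup>2 = measure lborel A"
    unfolding l2_norm_def * using assms by (simp add: integral_nonneg)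
qed

text \<open>For open \<open>U\<close> the product \<open>1\<^sub>U(x + h) 1\<^sub>U(x)\<close> converges to \<open>1\<^sub>U(x)\<close> pointwise, which by
  dominated convergence gives the convergence of the inner products.\<close>

lemma translation_continuous_open:
  assumes U: "open U" and fin: "emeasure lborel U < \<infinity>"
  shows "translation_continuous (\<lambda>x. indicator U x)"
  unfolding translation_continuous_def
proof (intro conjI allI impI)
  have [measurable]: "U \<in> sets borel" using U by simp
  have L: "(\<lambda>x. indicator U x) \<in> sq_integrable" using fin by (intro sq_integrable_indicator) auto
  show "(\<lambda>x. indicator U x) \<in> sq_integrable" by fact
  fix h :: "nat \<Rightarrow> 'a" assume h: "h \<longlonglongrightarrow> 0"
  have "(\<lambda>n. LINT x|lborel. indicator U (x + h n) * indicator U x :: real) \<longlonglongrightarrow> (LINT x|lborel. indicator U x)"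
  proof (rule integral_dominated_convergence[where w="indicator U"])
    show "integrable lborel (indicator U :: 'a \<Rightarrow> real)" using fin by simp
    show "AE x in lborel. (\<lambda>n. indicator U (x + h n) * indicator U x :: real) \<longlonglongrightarrow> indicator U x"
    proof (rule AE_I2)
      fix x
      show "(\<lambda>n. indicator U (x + h n) * indicator U x :: real) \<longlonglongrightarrow> indicator U x"
      \<comment> \<open>Outside U the product is 0 for every n, so boundary points cause no trouble;
        inside, openness keeps the shifted point in U eventually.\<close>
      proof (cases "x \<in> U")
        case True
        have "(\<lambda>n. x + h n) \<longlonglongrightarrow> x + 0" by (intro tendsto_intros h)
        then have "\<forall>\<^sub>F n in sequentially. x + h n \<in> U"
          using topological_tendstoD U True by fastforce
        then have "\<forall>\<^sub>F n in sequentially. indicator U x = (indicator U (x + h n) * indicator U x :: real)"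
          by eventually_elim (use True in simp)
        then show ?thesis by (rule Lim_transform_eventually[OF tendsto_const])
      qed simp
    qed
  qed (auto split: split_indicator)
  then have "(\<lambda>n. 2 * measure lborel U - 2 * (LINT x|lborel. indicator U (x + h n) * indicator U x))
      \<longlonglongrightarrow> 2 * measure lborel U - 2 * measure lborel U"
    by (intro tendsto_intros) simp
  \<comment> \<open>For values p, q in {0, 1} the squared difference is p + q - 2 p q, so the error
    depends on the product integral alone.\<close>
  moreover have "2 * measure lborel U - 2 * (LINT x|lborel. indicator U (x + h n) * indicator U x)
      = (l2_norm (\<lambda>x. indicator U (x + h n) - indicator U x))\<^sup>2" for n
  proof -
    have i: "integrable lborel (\<lambda>x. indicator U (x + h n) :: real)"
      using sq_integrableD(2)[OF sq_integrable_translate[OF L, of "h n"]]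
      by (rule Bochner_Integration.integrable_bound) (auto split: split_indicator)
    have ii: "integrable lborel (\<lambda>x. indicator U (x + h n) * indicator U x :: real)"
      using i by (rule Bochner_Integration.integrable_bound) (auto split: split_indicator)
    have "(l2_norm (\<lambda>x. indicator U (x + h n) - indicator U x))\<^sup>2
        = (LINT x|lborel. (cmod (indicator U (x + h n) - indicator U x))\<^sup>2)"
      by (simp add: l2_norm_def integral_nonneg)
    also have "\<dots> = (LINT x|lborel. indicator U (x + h n) + indicator U x
        - 2 * (indicator U (x + h n) * indicator U x) :: real)"
      by (intro Bochner_Integration.integral_cong) (auto split: split_indicator)
    also have "\<dots> = (LINT x|lborel. indicator U (x + h n) :: real) + measure lborel U
        - 2 * (LINT x|lborel. indicator U (x + h n) * indicator U x)"
      using i ii fin by simp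
    also have "(LINT x|lborel. indicator U (x + h n) :: real) = measure lborel U"
      by (subst integral_translate) auto
    finally show ?thesis by simp
  qed
  ultimately have "(\<lambda>n. (l2_norm (\<lambda>x. indicator U (x + h n) - indicator U x))\<^sup>2) \<longlonglongrightarrow> 0"
    by simp
  from tendsto_real_sqrt[OF this]
  show "(\<lambda>n. l2_norm (\<lambda>x. indicator U (x + h n) - indicator U x)) \<longlonglongrightarrow> 0"
    by simp
qed

lemma translation_continuous_indicator:
  assumes A: "A \<in> sets borel" and fin: "emeasure lborel A < \<infinity>"
  shows "translation_continuous (\<lambda>x. indicator A x)"
proof (rule translation_continuous_lim)
  show "(\<lambda>x. indicator A x) \<in> sq_integrable" using assms by (rule sq_integrable_indicator)
  fix e :: real assume e: "e > 0"
  \<comment> \<open>The norm of an indicator is the square root of the measure, hence outer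
    regularity is used with tolerance e^2.\<close>
  then have "e\<^sup>2 > 0" by simp
  from outer_regular_lborel[OF A this] obtain U where
    U: "open U" "A \<subseteq> U" "emeasure lborel (U - A) < e\<^sup>2" by auto
  have [measurable]: "U \<in> sets borel" using U by simp
  have d: "U - A \<in> sets borel" "emeasure lborel (U - A) < \<infinity>"
    using A U(3) by (auto intro: less_trans[OF _ ennreal_less_top])
  have "emeasure lborel U \<le> emeasure lborel A + emeasure lborel (U - A)"
    using A U(2) by (subst plus_emeasure) (auto simp: Un_absorb1)
  also have "\<dots> < \<infinity>" using fin d by simp
  finally have "translation_continuous (\<lambda>x. indicator U x)" by (intro translation_continuous_open U)
  moreover have "l2_norm (\<lambda>x. indicator A x - indicator U x) < e"
  proof -
    have "indicator A x - indicator U x = (-1) * (indicator (U - A) x :: complex)" for x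
      using U(2) by (auto split: split_indicator)
    then have "l2_norm (\<lambda>x. indicator A x - indicator U x) = l2_norm (\<lambda>x. indicator (U - A) x)"
      by (simp only: l2_norm_scale) simp
    moreover have "(l2_norm (\<lambda>x. indicator (U - A) x))\<^sup>2 < e\<^sup>2"
      using sq_integrable_indicator(2)[OF d] U(3) d(2)
      by (simp add: emeasure_eq_ennreal_measure less_top[symmetric] ennreal_less_iff)
    ultimately show ?thesis using e by (simp add: power_less_imp_less_base)
  qed
  ultimately show "\<exists>g. translation_continuous g \<and> l2_norm (\<lambda>x. indicator A x - g x) < e" by blast
qed

lemma translation_continuous_sq_integrable:
  assumes f: "f \<in> sq_integrable" shows "translation_continuous f"
proof -
  have [measurable]: "f \<in> borel_measurable borel" by (rule sq_integrableD(1)[OF f])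
  from borel_measurable_implies_sequence_metric[of f borel 0] obtain s where
    s: "\<And>i. simple_function borel (s i)" "\<And>x. (\<lambda>i. s i x) \<longlonglongrightarrow> f x"
       "\<And>i x. cmod (s i x) \<le> 2 * cmod (f x)"
    by auto
  have sm [measurable]: "s i \<in> borel_measurable borel" for i
    using s(1) by (rule borel_measurable_simple_function)
  note conv = l2_dominated_convergence[OF f sm s(3) s(2)]
  have tc: "translation_continuous (s i)" for i
  proof -
    have fin: "finite (range (s i))" using s(1)[of i] by (simp add: simple_function_def)
    have "translation_continuous (\<lambda>x. \<Sum>y\<in>range (s i). y * indicator (s i -` {y}) x)"
    proof (rule translation_continuous_sum)
      fix y assume "y \<in> range (s i)"
      show "translation_continuous (\<lambda>x. y * indicator (s i -` {y}) x)"
      \<comment> \<open>The level set of 0 may have infinite measure, but it contributes nothing.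
        For other values Chebyshev's estimate bounds the measure of the level set.\<close>
      proof (cases "y = 0")
        case False
        have m: "s i -` {y} \<in> sets borel" using measurable_sets_borel[OF sm, of "{y}" i] by simp
        have "ennreal ((cmod y)\<^sup>2) * emeasure lborel (s i -` {y})
            = (\<integral>\<^sup>+x. ennreal ((cmod y)\<^sup>2) * indicator (s i -` {y}) x \<partial>lborel)"
          using m by (simp add: nn_integral_cmult)
        also have "\<dots> \<le> (\<integral>\<^sup>+x. ennreal ((cmod (s i x))\<^sup>2) \<partial>lborel)"
          by (intro nn_integral_mono) (auto split: split_indicator)
        also have "\<dots> < \<infinity>" using conv(1)[of i] by (simp add: sq_integrable_iff_nn_integral)
        finally have "emeasure lborel (s i -` {y}) < \<infinity>"
          using False by (auto simp: ennreal_mult_less_top)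
        then show ?thesis
          by (intro translation_continuous_scale translation_continuous_indicator m)
      qed (simp add: translation_continuous_zero)
    qed
    moreover have "(\<Sum>y\<in>range (s i). y * indicator (s i -` {y}) x) = s i x" for x
    proof -
      have "(\<Sum>y\<in>range (s i). y * indicator (s i -` {y}) x) = (\<Sum>y\<in>range (s i). if y = s i x then y else 0)"
        by (intro sum.cong) (auto split: split_indicator)
      then show ?thesis using fin by simp
    qed
    ultimately show ?thesis by simp
  qed
  show ?thesis
  proof (rule translation_continuous_lim[OF f])
    fix e :: real assume "e > 0"
    then obtain i where "l2_norm (\<lambda>x. s i x - f x) < e"
      using LIMSEQ_D[OF conv(2), of e] by fastforce
    then show "\<exists>g. translation_continuous g \<and> l2_norm (\<lambda>x. f x - g x) < e"
      using tc[of i] l2_norm_minus_commute[of f "s i"] by auto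
  qed
qed


section \<open>Gaussian damping\<close>

lemma sigma_finite_lborels: "product_sigma_finite (\<lambda>_ :: 'a. lborel :: real measure)"
  by standard

text \<open>Lebesgue measure is the image of the product of one-dimensional Lebesgue measures under
  assembly of coordinates, so Fubini factorises a product of functions of separate coordinates. This
  reduces the Gaussian transform to dimension one.\<close>

lemma
  fixes f :: "'a::euclidean_space \<Rightarrow> real \<Rightarrow> 'b::{real_normed_field,banach,second_countable_topology}"
  assumes f: "\<And>b. b \<in> Basis \<Longrightarrow> integrable lborel (f b)"
  shows integrable_lborel_prod: "integrable lborel (\<lambda>x. \<Prod>b\<in>Basis. f b (x \<bullet> b))"
    and integral_lborel_prod:
      "(LINT x|lborel. (\<Prod>b\<in>Basis. f b (x \<bullet> b))) = (\<Prod>b\<in>Basis. (LINT x|lborel. f b x))"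
proof -
  interpret product_sigma_finite "\<lambda>_ :: 'a. lborel :: real measure" by (rule sigma_finite_lborels)
  have [measurable]: "\<And>b. b \<in> Basis \<Longrightarrow> f b \<in> borel_measurable borel"
    using borel_measurable_integrable[OF f] by simp
  have T: "(\<lambda>g. \<Sum>b\<in>Basis. g b *\<^sub>R b) \<in> measurable (\<Pi>\<^sub>M b\<in>Basis. lborel) (borel :: 'a measure)"
    by measurable
  have P: "(\<lambda>x. \<Prod>b\<in>Basis. f b (x \<bullet> b)) \<in> borel_measurable borel"
    by measurable
  have eq: "(\<Prod>b\<in>Basis. f b ((\<Sum>b'\<in>Basis. g b' *\<^sub>R b') \<bullet> b)) = (\<Prod>b\<in>Basis. f b (g b))" for g
    by (intro prod.cong) auto
  have "integrable (\<Pi>\<^sub>M b\<in>Basis. lborel) (\<lambda>g. \<Prod>b\<in>Basis. f b (g b))"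
    using f by (intro product_integrable_prod) auto
  then show "integrable lborel (\<lambda>x. \<Prod>b\<in>Basis. f b (x \<bullet> b))"
    by (subst lborel_eq, subst integrable_distr_eq[OF T]) (use P eq in auto)
  have "(LINT x|lborel. (\<Prod>b\<in>Basis. f b (x \<bullet> b))) = (LINT g|(\<Pi>\<^sub>M b\<in>Basis. lborel). (\<Prod>b\<in>Basis. f b (g b)))"
    by (subst lborel_eq, subst integral_distr[OF T]) (use P eq in auto)
  also have "\<dots> = (\<Prod>b\<in>Basis. (LINT x|lborel. f b x))"
    using f by (intro product_integral_prod) auto
  finally show "(LINT x|lborel. (\<Prod>b\<in>Basis. f b (x \<bullet> b))) = (\<Prod>b\<in>Basis. (LINT x|lborel. f b x))" .
qed

lemma
  fixes f :: "'a::euclidean_space \<Rightarrow> 'b::{banach, second_countable_topology}"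
  assumes f: "f \<in> borel_measurable borel" and c: "c \<noteq> 0"
  shows lborel_integral_affine:
      "(LINT x|lborel. f x) = \<bar>c\<bar> ^ DIM('a) *\<^sub>R (LINT x|lborel. f (t + c *\<^sub>R x))"
    and lborel_integrable_affine: "integrable lborel f \<Longrightarrow> integrable lborel (\<lambda>x. f (t + c *\<^sub>R x))"
proof -
  have m: "(\<lambda>x. t + c *\<^sub>R x) \<in> measurable lborel borel" by measurable
  show "(LINT x|lborel. f x) = \<bar>c\<bar> ^ DIM('a) *\<^sub>R (LINT x|lborel. f (t + c *\<^sub>R x))"
    using f m by (subst lborel_affine[OF c, of t]) (simp add: integral_density integral_distr)
  assume "integrable lborel f"
  then have "integrable (distr lborel borel (\<lambda>x. t + c *\<^sub>R x)) (\<lambda>x. \<bar>c\<bar> ^ DIM('a) *\<^sub>R f x)"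
    using f by (subst (asm) lborel_affine[OF c, of t]) (simp add: integrable_density)
  then have "integrable lborel (\<lambda>x. \<bar>c\<bar> ^ DIM('a) *\<^sub>R f (t + c *\<^sub>R x))"
    using f m by (simp add: integrable_distr_eq)
  then have "integrable lborel (\<lambda>x. inverse (\<bar>c\<bar> ^ DIM('a)) *\<^sub>R (\<bar>c\<bar> ^ DIM('a) *\<^sub>R f (t + c *\<^sub>R x)))"
    by (rule integrable_scaleR_right)
  moreover have "inverse (\<bar>c\<bar> ^ DIM('a)) *\<^sub>R (\<bar>c\<bar> ^ DIM('a) *\<^sub>R v) = v" for v :: 'b
    using c by simp
  ultimately show "integrable lborel (\<lambda>x. f (t + c *\<^sub>R x))"
    by (simp only:)
qed

section \<open>The Gaussian and its transform\<close>

definition gauss :: "'a::euclidean_space \<Rightarrow> real" where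
  "gauss x = exp (- (norm x)\<^sup>2 / 2)"

text \<open>The Fourier transform of \<open>gauss\<close>. With the factor 2 pi in the exponent,
  each coordinate becomes a normal density of standard deviation 1/(2 pi); writing it this way makes
  total mass 1 immediate.\<close>

definition gauss_kernel :: "'a::euclidean_space \<Rightarrow> real" where
  "gauss_kernel x = (\<Prod>b\<in>Basis. normal_density 0 (1 / (2 * pi)) (x \<bullet> b))"

lemma gauss_nonneg [simp]: "0 \<le> gauss x"
  by (simp add: gauss_def)

lemma gauss_prod: "gauss x = (\<Prod>b\<in>Basis. exp (- (x \<bullet> b)\<^sup>2 / 2))"
proof -
  have "(norm x)\<^sup>2 = (\<Sum>b\<in>Basis. (x \<bullet> b)\<^sup>2)"
    by (subst power2_norm_eq_inner, subst euclidean_inner) (simp add: power2_eq_square)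
  then show ?thesis
    by (simp add: gauss_def exp_sum[symmetric] sum_negf sum_divide_distrib)
qed

lemma measurable_gauss [measurable]: "gauss \<in> borel_measurable borel"
  unfolding gauss_def[abs_def] by measurable

lemma measurable_gauss_kernel [measurable]: "gauss_kernel \<in> borel_measurable borel"
  unfolding gauss_kernel_def[abs_def] by measurable

lemma gauss_kernel_nonneg: "0 \<le> gauss_kernel x"
  by (simp add: gauss_kernel_def prod_nonneg)

lemma measurable_cis [measurable]: "cis \<in> borel_measurable borel"
  unfolding cis_conv_exp[abs_def] by measurable

lemma integrable_exp_sq: "integrable lborel (\<lambda>x::real. exp (- x\<^sup>2 / 2))"
proof -
  have "integrable lborel (\<lambda>x. sqrt (2 * pi) * std_normal_density x)"
    by (intro integrable_mult_right integrable_normal_density) auto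
  then show ?thesis by (simp add: std_normal_density_def)
qed

lemma integrable_gauss: "integrable lborel gauss"
  unfolding gauss_prod[abs_def] by (intro integrable_lborel_prod integrable_exp_sq)

text \<open>The characteristic function of the standard normal law at -2 pi t is exp(-(2 pi t)^2/2);
  undoing the normalisation 1/sqrt(2 pi) gives a normal density again, because 2 pi times the
  variance 1/(2 pi)^2 is 1/(2 pi).\<close>

lemma integral_exp_sq_cis:
  "(LINT x|lborel. complex_of_real (exp (- x\<^sup>2 / 2)) * cis (- 2 * pi * (x * t)))
     = complex_of_real (normal_density 0 (1 / (2 * pi)) t)"
proof -
  have "char std_normal_distribution (- 2 * pi * t)
      = (LINT x|lborel. std_normal_density x *\<^sub>R iexp (- 2 * pi * t * x))"
    unfolding char_def by (subst integral_density) auto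
  also have "\<dots> = (LINT x|lborel. (1 / sqrt (2 * pi)) *\<^sub>R
      (complex_of_real (exp (- x\<^sup>2 / 2)) * cis (- 2 * pi * (x * t))))"
    by (intro Bochner_Integration.integral_cong)
      (simp_all add: std_normal_density_def scaleR_conv_of_real cis_conv_exp mult_ac)
  also have "\<dots> = (1 / sqrt (2 * pi)) *\<^sub>R
      (LINT x|lborel. complex_of_real (exp (- x\<^sup>2 / 2)) * cis (- 2 * pi * (x * t)))"
    by simp
  finally have "(LINT x|lborel. complex_of_real (exp (- x\<^sup>2 / 2)) * cis (- 2 * pi * (x * t)))
      = complex_of_real (sqrt (2 * pi) * exp (- (2 * pi * t)\<^sup>2 / 2))"
    by (simp add: char_std_normal_distribution scaleR_conv_of_real field_simps)
  also have "sqrt (2 * pi) * exp (- (2 * pi * t)\<^sup>2 / 2) = normal_density 0 (1 / (2 * pi)) t"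
  proof -
    have "2 * pi * (1 / (2 * pi))\<^sup>2 = 1 / (2 * pi)" by (simp add: power2_eq_square field_simps)
    then have "1 / sqrt (2 * pi * (1 / (2 * pi))\<^sup>2) = sqrt (2 * pi)" by (simp add: real_sqrt_divide)
    moreover have "- (t - 0)\<^sup>2 / (2 * (1 / (2 * pi))\<^sup>2) = - (2 * pi * t)\<^sup>2 / 2"
      by (simp add: power2_eq_square field_simps)
    ultimately show ?thesis unfolding normal_density_def by (simp only:)
  qed
  finally show ?thesis .
qed

lemma cis_sum: "finite I \<Longrightarrow> cis (\<Sum>i\<in>I. f i) = (\<Prod>i\<in>I. cis (f i))"
  by (induction I rule: finite_induct) (simp_all add: cis_mult[symmetric])

lemma fourier_integral_gauss:
  "fourier_integral (\<lambda>x. complex_of_real (gauss x)) z = complex_of_real (gauss_kernel z)"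
proof -
  have int: "integrable lborel (\<lambda>x. complex_of_real (exp (- x\<^sup>2 / 2)) * cis (- 2 * pi * (x * t)))" for t
  proof (rule Bochner_Integration.integrable_bound[OF integrable_exp_sq])
    show "(\<lambda>x. complex_of_real (exp (- x\<^sup>2 / 2)) * cis (- 2 * pi * (x * t))) \<in> borel_measurable lborel"
      by measurable
  qed (simp add: norm_mult)
  have "fourier_integral (\<lambda>x. complex_of_real (gauss x)) z
     = (LINT x|lborel. (\<Prod>b\<in>Basis. complex_of_real (exp (- (x \<bullet> b)\<^sup>2 / 2)) * cis (- 2 * pi * ((x \<bullet> b) * (z \<bullet> b)))))"
    unfolding fourier_integral_def
  proof (intro Bochner_Integration.integral_cong refl)
    fix x :: 'a
    have "cis (- 2 * pi * (x \<bullet> z)) = (\<Prod>b\<in>Basis. cis (- 2 * pi * ((x \<bullet> b) * (z \<bullet> b))))"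
      by (subst euclidean_inner) (simp add: sum_distrib_left cis_sum[symmetric])
    then show "complex_of_real (gauss x) * cis (- 2 * pi * (x \<bullet> z))
        = (\<Prod>b\<in>Basis. complex_of_real (exp (- (x \<bullet> b)\<^sup>2 / 2)) * cis (- 2 * pi * ((x \<bullet> b) * (z \<bullet> b))))"
      by (simp add: gauss_prod prod.distrib)
  qed
  also have "\<dots> = (\<Prod>b\<in>Basis. (LINT x|lborel. complex_of_real (exp (- x\<^sup>2 / 2)) * cis (- 2 * pi * (x * (z \<bullet> b)))))"
    by (rule integral_lborel_prod) (rule int)
  also have "\<dots> = complex_of_real (gauss_kernel z)"
    by (simp only: integral_exp_sq_cis gauss_kernel_def of_real_prod)
  finally show ?thesis .
qed

section \<open>Fourier integrals of integrable functions\<close>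

lemma integrable_mult_cis:
  fixes f :: "'a::euclidean_space \<Rightarrow> complex"
  assumes "integrable lborel f"
  shows "integrable lborel (\<lambda>x. f x * cis (s * (x \<bullet> z)))"
proof (rule Bochner_Integration.integrable_bound[OF assms])
  have [measurable]: "f \<in> borel_measurable borel"
    using borel_measurable_integrable[OF assms] by simp
  show "(\<lambda>x. f x * cis (s * (x \<bullet> z))) \<in> borel_measurable lborel" by measurable
qed (simp add: norm_mult)

lemma measurable_integral_cis [measurable]:
  fixes f :: "'a::euclidean_space \<Rightarrow> complex"
  assumes [measurable]: "f \<in> borel_measurable borel"
  shows "(\<lambda>z. LINT x|lborel. f x * cis (s * (x \<bullet> z))) \<in> borel_measurable borel"
  by measurable

lemma norm_integral_cis_le:
  fixes f :: "'a::euclidean_space \<Rightarrow> complex"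
  shows "cmod (LINT x|lborel. f x * cis (s * (x \<bullet> z))) \<le> (LINT x|lborel. cmod (f x))"
  using integral_norm_bound[of lborel "\<lambda>x. f x * cis (s * (x \<bullet> z))"] by (simp add: norm_mult)

text \<open>Fubini, with f(x) h(z) as integrable majorant. The free factor \<open>s\<close> covers
  both signs of the exponent: 2 pi for smoothing and -2 pi for Plancherel.\<close>

lemma fourier_multiplication_formula:
  fixes f h :: "'a::euclidean_space \<Rightarrow> complex"
  assumes f: "integrable lborel f" and h: "integrable lborel h"
  shows "(LINT z|lborel. (LINT x|lborel. f x * cis (s * (x \<bullet> z))) * h z)
       = (LINT x|lborel. f x * (LINT z|lborel. h z * cis (s * (z \<bullet> x))))"
proof -
  have [measurable]: "f \<in> borel_measurable borel" "h \<in> borel_measurable borel"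
    using borel_measurable_integrable[OF f] borel_measurable_integrable[OF h] by simp_all
  have int: "integrable (lborel \<Otimes>\<^sub>M lborel) (\<lambda>(x, z). f x * h z * cis (s * (x \<bullet> z)))"
  proof (rule Bochner_Integration.integrable_bound)
    show "integrable (lborel \<Otimes>\<^sub>M lborel) (\<lambda>(x, z). f x * h z)"
      using f h by (intro lborel_pair.Fubini_integrable) (auto simp: norm_mult)
    show "(\<lambda>(x, z). f x * h z * cis (s * (x \<bullet> z))) \<in> borel_measurable (lborel \<Otimes>\<^sub>M lborel)"
      by measurable
  qed (auto simp: norm_mult)
  have "(LINT x|lborel. f x * cis (s * (x \<bullet> z))) * h z = (LINT x|lborel. f x * h z * cis (s * (x \<bullet> z)))" for z
    by (subst integral_mult_left_zero[symmetric]) (simp add: mult_ac)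
  then have "(LINT z|lborel. (LINT x|lborel. f x * cis (s * (x \<bullet> z))) * h z)
      = (LINT z|lborel. (LINT x|lborel. f x * h z * cis (s * (x \<bullet> z))))"
    by simp
  also have "\<dots> = (LINT x|lborel. (LINT z|lborel. f x * h z * cis (s * (x \<bullet> z))))"
    using int by (rule lborel_pair.Fubini_integral)
  also have "\<dots> = (LINT x|lborel. f x * (LINT z|lborel. h z * cis (s * (z \<bullet> x))))"
    by (simp add: mult.assoc inner_commute)
  finally show ?thesis .
qed

section \<open>Averages over Gaussian translates\<close>

definition gauss_measure :: "'a::euclidean_space measure" where
  "gauss_measure = density lborel (\<lambda>y. ennreal (gauss_kernel y))"

lemma sets_gauss_measure [simp, measurable_cong]: "sets gauss_measure = sets borel"
  by (simp add: gauss_measure_def)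

lemma space_gauss_measure [simp]: "space gauss_measure = UNIV"
  by (simp add: gauss_measure_def)

lemma prob_space_gauss_measure: "prob_space gauss_measure"
proof
  have "emeasure gauss_measure (space (gauss_measure :: 'a measure)) = (\<integral>\<^sup>+y. ennreal (gauss_kernel (y::'a)) \<partial>lborel)"
    by (simp add: gauss_measure_def emeasure_density)
  also have "\<dots> = (\<integral>\<^sup>+y. (\<Prod>b\<in>Basis. ennreal (normal_density 0 (1 / (2 * pi)) ((y::'a) \<bullet> b))) \<partial>lborel)"
    by (simp add: gauss_kernel_def prod_ennreal)
  also have "\<dots> = (\<Prod>b\<in>(Basis :: 'a set). (\<integral>\<^sup>+x. ennreal (normal_density 0 (1 / (2 * pi)) x) \<partial>lborel))"
    by (rule nn_integral_lborel_prod) auto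
  also have "(\<integral>\<^sup>+x. ennreal (normal_density 0 (1 / (2 * pi)) x) \<partial>lborel) = 1"
    by (subst nn_integral_eq_integral) auto
  finally show "emeasure gauss_measure (space (gauss_measure :: 'a measure)) = 1" by simp
qed

text \<open>Convolution with the kernel dilated by \<open>e\<close>, written as an expectation of
  translates so that continuity of translations can be used under the integral.\<close>

definition gauss_smooth :: "real \<Rightarrow> ('a::euclidean_space \<Rightarrow> complex) \<Rightarrow> 'a \<Rightarrow> complex" where
  "gauss_smooth e g x = (LINT y|gauss_measure. g (x - e *\<^sub>R y))"

text \<open>The kernel is a Fourier transform, hence bounded by the integral of
  \<open>gauss\<close>. A bounded density keeps Lebesgue integrable functions integrable for
  \<open>gauss_measure\<close>.\<close>

lemma gauss_kernel_le:
  fixes z :: "'a::euclidean_space"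
  shows "gauss_kernel z \<le> (LINT x|lborel. gauss (x :: 'a))"
proof -
  have "cmod (fourier_integral (\<lambda>x. complex_of_real (gauss x)) z) \<le> (LINT x|lborel. cmod (complex_of_real (gauss (x :: 'a))))"
    unfolding fourier_integral_def by (rule norm_integral_cis_le)
  then show ?thesis
    using gauss_kernel_nonneg[of z] by (simp add: fourier_integral_gauss)
qed

lemma integrable_gauss_measure:
  fixes g :: "'a::euclidean_space \<Rightarrow> complex"
  assumes g: "integrable lborel g" and e: "e \<noteq> 0"
  shows "integrable gauss_measure (\<lambda>y. g (x - e *\<^sub>R y))"
proof -
  have [measurable]: "g \<in> borel_measurable borel"
    using borel_measurable_integrable[OF g] by simp
  have "integrable lborel (\<lambda>y. g (x + (- e) *\<^sub>R y))"
    using g e by (intro lborel_integrable_affine) auto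
  then have "integrable lborel (\<lambda>y. (LINT x|lborel. gauss (x :: 'a)) *\<^sub>R g (x - e *\<^sub>R y))"
    by simp
  then have "integrable lborel (\<lambda>y. gauss_kernel y *\<^sub>R g (x - e *\<^sub>R y))"
  proof (rule Bochner_Integration.integrable_bound)
    show "AE y in lborel. norm (gauss_kernel y *\<^sub>R g (x - e *\<^sub>R y))
        \<le> norm ((LINT x|lborel. gauss (x :: 'a)) *\<^sub>R g (x - e *\<^sub>R y))"
      by (intro AE_I2) (auto intro!: mult_right_mono simp: gauss_kernel_le abs_of_nonneg[OF gauss_kernel_nonneg])
  qed measurable
  then show ?thesis
    unfolding gauss_measure_def by (subst integrable_density) (auto simp: gauss_kernel_nonneg)
qed

lemma fourier_integral_gauss_scaled:
  assumes e: "e > 0"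
  shows "(LINT \<xi>|lborel. complex_of_real (gauss (e *\<^sub>R \<xi>)) * cis (- 2 * pi * (\<xi> \<bullet> (z :: 'a::euclidean_space))))
     = complex_of_real (gauss_kernel (z /\<^sub>R e) / e ^ DIM('a))"
proof -
  let ?f = "\<lambda>x. complex_of_real (gauss x) * cis (- 2 * pi * (x \<bullet> (z /\<^sub>R e)))"
  have "complex_of_real (gauss_kernel (z /\<^sub>R e)) = (LINT x|lborel. ?f x)"
    unfolding fourier_integral_gauss[symmetric] fourier_integral_def ..
  also have "\<dots> = \<bar>e\<bar> ^ DIM('a) *\<^sub>R (LINT x|lborel. ?f (0 + e *\<^sub>R x))"
    using e by (intro lborel_integral_affine) auto
  also have "(\<lambda>x. ?f (0 + e *\<^sub>R x)) = (\<lambda>\<xi>. complex_of_real (gauss (e *\<^sub>R \<xi>)) * cis (- 2 * pi * (\<xi> \<bullet> z)))"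
  proof -
    have "(e *\<^sub>R x) \<bullet> (z /\<^sub>R e) = x \<bullet> z" for x using e by simp
    then show ?thesis by (simp only: add_0)
  qed
  finally show ?thesis using e by (simp add: scaleR_conv_of_real field_simps)
qed

lemma integrable_gauss_scaled_bounded:
  fixes p :: "'a::euclidean_space \<Rightarrow> complex"
  assumes [measurable]: "p \<in> borel_measurable borel" and b: "\<And>x. cmod (p x) \<le> C" and e: "e \<noteq> 0"
  shows "integrable lborel (\<lambda>\<xi>. complex_of_real (gauss (e *\<^sub>R \<xi>)) * p \<xi>)"
proof (rule Bochner_Integration.integrable_bound)
  show "integrable lborel (\<lambda>\<xi>::'a. gauss (0 + e *\<^sub>R \<xi>) * C)"
    using e by (intro integrable_mult_left lborel_integrable_affine integrable_gauss) auto
  have "0 \<le> C" using b order_trans norm_ge_zero by blast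
  then show "AE x in lborel. norm (complex_of_real (gauss (e *\<^sub>R x)) * p x) \<le> norm (gauss (0 + e *\<^sub>R x) * C)"
    using b by (auto simp: norm_mult gauss_def intro!: mult_left_mono)
qed measurable

text \<open>The multiplication formula moves the transform from \<open>g\<close> onto the damped
  character, whose transform is the dilated kernel centred at \<open>x\<close>. Thus inversion holds
  up to smoothing.\<close>

lemma fourier_integral_gauss_damped:
  fixes g :: "'a::euclidean_space \<Rightarrow> complex"
  assumes g: "integrable lborel g" and e: "e > 0"
  shows "fourier_integral (\<lambda>\<xi>. complex_of_real (gauss (e *\<^sub>R \<xi>)) *
     (LINT \<eta>|lborel. g \<eta> * cis (2 * pi * (\<eta> \<bullet> \<xi>)))) x = gauss_smooth e g x"
proof -
  have [measurable]: "g \<in> borel_measurable borel"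
    using borel_measurable_integrable[OF g] by simp
  let ?h = "\<lambda>\<xi>. complex_of_real (gauss (e *\<^sub>R \<xi>)) * cis (- 2 * pi * (\<xi> \<bullet> x))"
  have h: "integrable lborel ?h"
    using e by (intro integrable_gauss_scaled_bounded[where C=1]) auto
  have inner: "(LINT \<xi>|lborel. ?h \<xi> * cis (2 * pi * (\<xi> \<bullet> \<eta>))) = complex_of_real (gauss_kernel ((x - \<eta>) /\<^sub>R e) / e ^ DIM('a))" for \<eta>
    unfolding fourier_integral_gauss_scaled[OF e, symmetric]
    by (intro Bochner_Integration.integral_cong refl)
      (simp add: mult.assoc cis_mult inner_diff_right algebra_simps)
  let ?k = "\<lambda>\<eta>. g \<eta> * complex_of_real (gauss_kernel ((x - \<eta>) /\<^sub>R e) / e ^ DIM('a))"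
  have "fourier_integral (\<lambda>\<xi>. complex_of_real (gauss (e *\<^sub>R \<xi>)) *
     (LINT \<eta>|lborel. g \<eta> * cis (2 * pi * (\<eta> \<bullet> \<xi>)))) x
     = (LINT \<xi>|lborel. (LINT \<eta>|lborel. g \<eta> * cis (2 * pi * (\<eta> \<bullet> \<xi>))) * ?h \<xi>)"
    unfolding fourier_integral_def by (intro Bochner_Integration.integral_cong) auto
  also have "\<dots> = (LINT \<eta>|lborel. ?k \<eta>)"
    unfolding fourier_multiplication_formula[OF g h] inner ..
  \<comment> \<open>Substitution \<eta> = x - e y: its Jacobian cancels the power of
    \<open>e\<close> in the kernel, and the argument of the kernel becomes y.\<close>
  also have "\<dots> = \<bar>- e\<bar> ^ DIM('a) *\<^sub>R (LINT y|lborel. ?k (x + (- e) *\<^sub>R y))"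
    using e by (intro lborel_integral_affine) auto
  also have "\<dots> = (LINT y|lborel. \<bar>- e\<bar> ^ DIM('a) *\<^sub>R ?k (x + (- e) *\<^sub>R y))"
    by (rule integral_scaleR_right[symmetric])
  also have "\<dots> = (LINT y|lborel. gauss_kernel y *\<^sub>R g (x - e *\<^sub>R y))"
    using e by (intro Bochner_Integration.integral_cong) (auto simp: scaleR_conv_of_real field_simps)
  also have "\<dots> = gauss_smooth e g x"
    unfolding gauss_smooth_def gauss_measure_def
    by (subst integral_density) (auto simp: gauss_kernel_nonneg)
  finally show ?thesis .
qed


section \<open>Plancherel's theorem\<close>

text \<open>By the Cauchy-Schwarz inequality for the Gaussian probability measure, the squared \<open>L\<^sup>2\<close> error
  of the smoothing is at most the mean of the squared \<open>L\<^sup>2\<close> moduli of continuity.\<close>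

lemma nn_integral_gauss_smooth_diff_le:
  fixes g :: "'a::euclidean_space \<Rightarrow> complex"
  assumes g: "integrable lborel g" and e: "e \<noteq> 0"
  shows "(\<integral>\<^sup>+x. ennreal ((cmod (gauss_smooth e g x - g x))\<^sup>2) \<partial>lborel)
     \<le> (\<integral>\<^sup>+y. (\<integral>\<^sup>+x. ennreal ((cmod (g (x - e *\<^sub>R y) - g x))\<^sup>2) \<partial>lborel) \<partial>gauss_measure)"
proof -
  have [measurable]: "g \<in> borel_measurable borel"
    using borel_measurable_integrable[OF g] by simp
  interpret prob_space "gauss_measure :: 'a measure" by (rule prob_space_gauss_measure)
  interpret pair_sigma_finite "gauss_measure :: 'a measure" "lborel :: 'a measure" ..
  have "ennreal ((cmod (gauss_smooth e g x - g x))\<^sup>2)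
      \<le> (\<integral>\<^sup>+y. ennreal ((cmod (g (x - e *\<^sub>R y) - g x))\<^sup>2) \<partial>gauss_measure)" for x
  proof -
    have int: "integrable gauss_measure (\<lambda>y. g (x - e *\<^sub>R y) - g x)"
      using integrable_gauss_measure[OF g e] by simp
    have "gauss_smooth e g x - g x = (LINT y|gauss_measure. g (x - e *\<^sub>R y) - g x)"
      unfolding gauss_smooth_def using integrable_gauss_measure[OF g e] prob_space by simp
    then have "ennreal (cmod (gauss_smooth e g x - g x))
        \<le> (\<integral>\<^sup>+y. ennreal (cmod (g (x - e *\<^sub>R y) - g x)) * 1 \<partial>gauss_measure)"
      using integral_norm_bound_ennreal[OF int] by simp
    then have "(ennreal (cmod (gauss_smooth e g x - g x)))\<^sup>2
        \<le> (\<integral>\<^sup>+y. ennreal (cmod (g (x - e *\<^sub>R y) - g x)) * 1 \<partial>gauss_measure)\<^sup>2"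
      by (rule power_mono) simp
    also have "\<dots> \<le> (\<integral>\<^sup>+y. (ennreal (cmod (g (x - e *\<^sub>R y) - g x)))\<^sup>2 \<partial>gauss_measure)
        * (\<integral>\<^sup>+y. 1\<^sup>2 \<partial>(gauss_measure :: 'a measure))"
      by (rule Cauchy_Schwarz_nn_integral) auto
    finally show ?thesis using emeasure_space_1 by (simp add: ennreal_power)
  qed
  then have "(\<integral>\<^sup>+x. ennreal ((cmod (gauss_smooth e g x - g x))\<^sup>2) \<partial>lborel)
      \<le> (\<integral>\<^sup>+x. (\<integral>\<^sup>+y. ennreal ((cmod (g (x - e *\<^sub>R y) - g x))\<^sup>2) \<partial>gauss_measure) \<partial>lborel)"
    by (intro nn_integral_mono)
  also have "\<dots> = (\<integral>\<^sup>+y. (\<integral>\<^sup>+x. ennreal ((cmod (g (x - e *\<^sub>R y) - g x))\<^sup>2) \<partial>lborel) \<partial>gauss_measure)"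
    by (rule Fubini') measurable
  finally show ?thesis .
qed

text \<open>For each y the inner norm tends to 0 by continuity of translations, and it never exceeds
  twice the norm of \<open>g\<close>; a constant is integrable for a probability measure, so
  dominated convergence in y applies. Membership is claimed eventually because it is read off from
  the error being small.\<close>

lemma gauss_smooth_l2:
  fixes g :: "'a::euclidean_space \<Rightarrow> complex"
  assumes g: "integrable lborel g" "g \<in> sq_integrable"
    and e: "\<And>n. e n \<noteq> 0" "e \<longlonglongrightarrow> 0"
  shows "\<forall>\<^sub>F n in sequentially. gauss_smooth (e n) g \<in> sq_integrable"
    and "(\<lambda>n. l2_norm (\<lambda>x. gauss_smooth (e n) g x - g x)) \<longlonglongrightarrow> 0"
proof -
  have [measurable]: "g \<in> borel_measurable borel"
    using borel_measurable_integrable[OF g(1)] by simp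
  interpret prob_space "gauss_measure :: 'a measure" by (rule prob_space_gauss_measure)
  define T where "T c y = (\<integral>\<^sup>+x. ennreal ((cmod (g (x - c *\<^sub>R y) - g x))\<^sup>2) \<partial>lborel)" for c y
  have T [measurable]: "T c \<in> borel_measurable borel" for c
    unfolding T_def[abs_def] by measurable
  have T_eq: "T c y = ennreal ((l2_norm (\<lambda>x. g (x + (- c *\<^sub>R y)) - g x))\<^sup>2)" for c y
    using nn_integral_sq_eq_l2_norm[OF sq_integrable_diff[OF sq_integrable_translate[OF g(2)] g(2)], of "- c *\<^sub>R y"]
    by (simp add: T_def)
  have "(\<lambda>n. \<integral>\<^sup>+y. T (e n) y \<partial>gauss_measure) \<longlonglongrightarrow> (\<integral>\<^sup>+y. 0 \<partial>(gauss_measure :: 'a measure))"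
  proof (rule nn_integral_dominated_convergence[where w="\<lambda>_. ennreal ((2 * l2_norm g)\<^sup>2)"])
    show "AE y in gauss_measure. T (e n) y \<le> ennreal ((2 * l2_norm g)\<^sup>2)" for n
    proof (rule AE_I2)
      fix y :: 'a
      have "l2_norm (\<lambda>x. g (x + (- e n *\<^sub>R y)) + (-1) * g x)
          \<le> l2_norm (\<lambda>x. g (x + (- e n *\<^sub>R y))) + l2_norm (\<lambda>x. (-1) * g x)"
        using g by (intro l2_norm_triangle sq_integrable_translate sq_integrable_scale)
      also have "\<dots> = 2 * l2_norm g"
        by (subst l2_norm_scale, subst l2_norm_translate) auto
      finally show "T (e n) y \<le> ennreal ((2 * l2_norm g)\<^sup>2)"
        unfolding T_eq by (intro ennreal_leI power_mono) auto
    qed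
    show "AE y in gauss_measure. (\<lambda>n. T (e n) y) \<longlonglongrightarrow> 0"
    proof (rule AE_I2)
      fix y :: 'a
      have "(\<lambda>n. - e n *\<^sub>R y) \<longlonglongrightarrow> - 0 *\<^sub>R y" by (intro tendsto_intros e)
      then have "(\<lambda>n. - e n *\<^sub>R y) \<longlonglongrightarrow> 0" by simp
      then have "(\<lambda>n. l2_norm (\<lambda>x. g (x + (- e n *\<^sub>R y)) - g x)) \<longlonglongrightarrow> 0"
        using translation_continuous_sq_integrable[OF g(2)]
        unfolding translation_continuous_def by blast
      from tendsto_power[OF this, of 2] have "(\<lambda>n. ennreal ((l2_norm (\<lambda>x. g (x + (- e n *\<^sub>R y)) - g x))\<^sup>2)) \<longlonglongrightarrow> ennreal 0"
        by (intro tendsto_ennrealI) simp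
      then show "(\<lambda>n. T (e n) y) \<longlonglongrightarrow> 0" by (simp add: T_eq)
    qed
    show "(\<integral>\<^sup>+y. ennreal ((2 * l2_norm g)\<^sup>2) \<partial>(gauss_measure :: 'a measure)) < \<infinity>"
      using emeasure_space_1 by (simp add: nn_integral_const)
  qed auto
  then have lim: "(\<lambda>n. \<integral>\<^sup>+y. T (e n) y \<partial>gauss_measure) \<longlonglongrightarrow> 0" by simp
  have sm [measurable]: "gauss_smooth (e n) g \<in> borel_measurable borel" for n
    unfolding gauss_smooth_def[abs_def] by measurable
  have le: "(\<integral>\<^sup>+x. ennreal ((cmod (gauss_smooth (e n) g x - g x))\<^sup>2) \<partial>lborel) \<le> (\<integral>\<^sup>+y. T (e n) y \<partial>gauss_measure)" for n
    unfolding T_def using g e by (intro nn_integral_gauss_smooth_diff_le)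
  have small: "\<forall>\<^sub>F n in sequentially. (\<lambda>x. gauss_smooth (e n) g x - g x) \<in> sq_integrable \<and>
      (l2_norm (\<lambda>x. gauss_smooth (e n) g x - g x))\<^sup>2 \<le> c" if c: "c > 0" for c
  proof -
    have "\<forall>\<^sub>F n in sequentially. (\<integral>\<^sup>+y. T (e n) y \<partial>gauss_measure) < ennreal c"
      using order_tendstoD(2)[OF lim, of "ennreal c"] c by simp
    then show ?thesis
    proof eventually_elim
      case (elim n)
      have "(\<integral>\<^sup>+x. ennreal ((cmod (gauss_smooth (e n) g x - g x))\<^sup>2) \<partial>lborel) \<le> ennreal c"
        using le[of n] elim by auto
      then show ?case
        using sq_integrable_nn_integralI[of "\<lambda>x. gauss_smooth (e n) g x - g x" c] c by auto
    qed
  qed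
  show "\<forall>\<^sub>F n in sequentially. gauss_smooth (e n) g \<in> sq_integrable"
    using small[of 1, OF zero_less_one]
  proof eventually_elim
    case (elim n)
    then show ?case
      using sq_integrable_add[of "\<lambda>x. gauss_smooth (e n) g x - g x" g] g by simp
  qed
  show "(\<lambda>n. l2_norm (\<lambda>x. gauss_smooth (e n) g x - g x)) \<longlonglongrightarrow> 0"
  proof (rule tendstoI)
    fix d :: real assume d: "d > 0"
    then have "(d / 2)\<^sup>2 > 0" by simp
    from small[OF this] show "\<forall>\<^sub>F n in sequentially. dist (l2_norm (\<lambda>x. gauss_smooth (e n) g x - g x)) 0 < d"
    proof eventually_elim
      case (elim n)
      then have "l2_norm (\<lambda>x. gauss_smooth (e n) g x - g x) \<le> d / 2"
        using d by (auto intro: power2_le_imp_le[of _ "d / 2"])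
      then show ?case using d by simp
    qed
  qed
qed

lemma measurable_fourier_integral:
  assumes "f \<in> borel_measurable borel" shows "fourier_integral f \<in> borel_measurable borel"
  unfolding fourier_integral_def[abs_def] using assms by (rule measurable_integral_cis)

lemma cnj_fourier_integral:
  "cnj (fourier_integral f \<xi>) = (LINT x|lborel. cnj (f x) * cis (2 * pi * (x \<bullet> \<xi>)))"
proof -
  have "cnj (fourier_integral f \<xi>) = (LINT x|lborel. cnj (f x * cis (- 2 * pi * (x \<bullet> \<xi>))))"
    unfolding fourier_integral_def by (rule Bochner_Integration.integral_cnj[symmetric])
  then show ?thesis by (simp add: cis_cnj)
qed

text \<open>The integral of the damped squared transform \<open>W n\<close> equals that of
  \<open>f\<close> times the smoothed conjugate of \<open>f\<close>, which tends to the squared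
  norm. As \<open>W n\<close> increases to the undamped square, monotone convergence yields
  integrability and the value together.\<close>

theorem Plancherel:
  fixes f :: "'a::euclidean_space \<Rightarrow> complex"
  assumes f: "integrable lborel f" "f \<in> sq_integrable"
  shows "fourier_integral f \<in> sq_integrable" and "l2_norm (fourier_integral f) = l2_norm f"
proof -
  have [measurable]: "f \<in> borel_measurable borel"
    using borel_measurable_integrable[OF f(1)] by simp
  note [measurable] = measurable_fourier_integral
  define e where "e n = 1 / real (Suc n)" for n
  have e: "e n > 0" for n by (simp add: e_def)
  have e0: "e \<longlonglongrightarrow> 0" unfolding e_def[abs_def] by (rule LIMSEQ_Suc[OF lim_1_over_n])
  define C where "C = (LINT x|lborel. cmod (f x))"
  have C: "cmod (fourier_integral f \<xi>) \<le> C" for \<xi>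
    unfolding fourier_integral_def C_def by (rule norm_integral_cis_le)
  define W where "W n \<xi> = gauss (e n *\<^sub>R \<xi>) * (cmod (fourier_integral f \<xi>))\<^sup>2" for n \<xi>
  have cf: "integrable lborel (\<lambda>x. cnj (f x))" "(\<lambda>x. cnj (f x)) \<in> sq_integrable"
    using f by auto
  have W_complex: "complex_of_real (W n \<xi>)
      = fourier_integral f \<xi> * (complex_of_real (gauss (e n *\<^sub>R \<xi>)) * cnj (fourier_integral f \<xi>))" for n \<xi>
    by (simp add: W_def mult_ac complex_norm_square del: of_real_power)
  \<comment> \<open>The transform is bounded by the integral \<open>C\<close> of the modulus of
    \<open>f\<close>, so one Gaussian factor secures integrability; for \<open>W n\<close> the
    second transform factor costs only another \<open>C\<close>.\<close>
  have h: "integrable lborel (\<lambda>\<xi>. complex_of_real (gauss (e n *\<^sub>R \<xi>)) * cnj (fourier_integral f \<xi>))" for n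
  proof (rule integrable_gauss_scaled_bounded)
    show "(\<lambda>\<xi>. cnj (fourier_integral f \<xi>)) \<in> borel_measurable borel"
      by (intro borel_measurable_continuous_on[of cnj] continuous_intros) measurable
  qed (use C e in \<open>auto simp: less_imp_neq[symmetric]\<close>)
  have W_int: "integrable lborel (W n)" for n
  proof (rule Bochner_Integration.integrable_bound)
    show "integrable lborel (\<lambda>\<xi>. C * cmod (complex_of_real (gauss (e n *\<^sub>R \<xi>)) * cnj (fourier_integral f \<xi>)))"
      by (intro integrable_mult_right integrable_norm h)
    show "AE \<xi> in lborel. norm (W n \<xi>) \<le> norm (C * cmod (complex_of_real (gauss (e n *\<^sub>R \<xi>)) * cnj (fourier_integral f \<xi>)))"
    proof (rule AE_I2)
      fix \<xi> :: 'a
      have "W n \<xi> = cmod (fourier_integral f \<xi>) * cmod (complex_of_real (gauss (e n *\<^sub>R \<xi>)) * cnj (fourier_integral f \<xi>))"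
        by (simp add: W_def norm_mult power2_eq_square)
      also have "\<dots> \<le> C * cmod (complex_of_real (gauss (e n *\<^sub>R \<xi>)) * cnj (fourier_integral f \<xi>))"
        using C by (intro mult_right_mono) auto
      finally show "norm (W n \<xi>) \<le> norm (C * cmod (complex_of_real (gauss (e n *\<^sub>R \<xi>)) * cnj (fourier_integral f \<xi>)))"
        by (simp add: W_def)
    qed
  qed (simp add: W_def[abs_def])
  have W_eq: "complex_of_real (integral\<^sup>L lborel (W n)) = (LINT x|lborel. f x * gauss_smooth (e n) (\<lambda>x. cnj (f x)) x)" for n
  proof -
    let ?h = "\<lambda>\<xi>. complex_of_real (gauss (e n *\<^sub>R \<xi>)) * cnj (fourier_integral f \<xi>)"
    have "complex_of_real (integral\<^sup>L lborel (W n)) = (LINT \<xi>|lborel. fourier_integral f \<xi> * ?h \<xi>)"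
      by (simp only: W_complex[symmetric] integral_complex_of_real)
    also have "\<dots> = (LINT x|lborel. f x * fourier_integral ?h x)"
      using fourier_multiplication_formula[OF f(1) h, of "- 2 * pi"] by (simp add: fourier_integral_def)
    \<comment> \<open>The conjugate of the transform of \<open>f\<close> is the inverse Fourier
      integral of the conjugate of \<open>f\<close>, so the damped formula applies to the
      latter.\<close>
    also have "fourier_integral ?h = gauss_smooth (e n) (\<lambda>x. cnj (f x))"
      unfolding cnj_fourier_integral using fourier_integral_gauss_damped[OF cf(1) e] by (intro ext)
    finally show ?thesis .
  qed
  have norm_f: "complex_of_real ((l2_norm f)\<^sup>2) = (LINT x|lborel. f x * cnj (f x))"
    using l2_inner_self[of f] by (simp add: l2_inner_def)
  note smooth = gauss_smooth_l2[OF cf less_imp_neq[OF e, symmetric] e0]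
  have "(\<lambda>n. integral\<^sup>L lborel (W n)) \<longlonglongrightarrow> (l2_norm f)\<^sup>2"
  proof (rule LIM_zero_cancel, rule Lim_null_comparison)
    show "(\<lambda>n. l2_norm f * l2_norm (\<lambda>x. gauss_smooth (e n) (\<lambda>x. cnj (f x)) x - cnj (f x))) \<longlonglongrightarrow> 0"
      by (rule tendsto_mult_right_zero[OF smooth(2)])
    show "\<forall>\<^sub>F n in sequentially. norm (integral\<^sup>L lborel (W n) - (l2_norm f)\<^sup>2)
        \<le> l2_norm f * l2_norm (\<lambda>x. gauss_smooth (e n) (\<lambda>x. cnj (f x)) x - cnj (f x))"
      using smooth(1)
    proof eventually_elim
      case (elim n)
      have "norm (integral\<^sup>L lborel (W n) - (l2_norm f)\<^sup>2)
          = cmod (complex_of_real (integral\<^sup>L lborel (W n)) - complex_of_real ((l2_norm f)\<^sup>2))"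
        by (simp only: of_real_diff[symmetric] norm_of_real real_norm_def)
      also have "complex_of_real (integral\<^sup>L lborel (W n)) - complex_of_real ((l2_norm f)\<^sup>2)
          = (LINT x|lborel. f x * (gauss_smooth (e n) (\<lambda>x. cnj (f x)) x - cnj (f x)))"
        unfolding W_eq norm_f using sq_integrable_integrable_mult[OF f(2) elim]
          sq_integrable_integrable_mult[OF f(2) cf(2)]
        by (simp add: right_diff_distrib)
      also have "cmod \<dots> \<le> l2_norm f * l2_norm (\<lambda>x. gauss_smooth (e n) (\<lambda>x. cnj (f x)) x - cnj (f x))"
        by (intro norm_integral_mult_le_l2 f sq_integrable_diff elim cf)
      finally show ?case .
    qed
  qed
  moreover have "AE \<xi> in lborel. mono (\<lambda>n. W n \<xi>)"
  proof (rule AE_I2, rule monoI)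
    fix \<xi> :: 'a and m n :: nat assume "m \<le> n"
    then have "e n \<le> e m" by (simp add: e_def frac_le)
    then have "norm (e n *\<^sub>R \<xi>) \<le> norm (e m *\<^sub>R \<xi>)"
      using e[of n] e[of m] by (simp add: mult_right_mono)
    then have "gauss (e m *\<^sub>R \<xi>) \<le> gauss (e n *\<^sub>R \<xi>)"
      unfolding gauss_def by (simp del: norm_scaleR add: power_mono)
    then show "W m \<xi> \<le> W n \<xi>" unfolding W_def by (intro mult_right_mono) auto
  qed
  moreover have "AE \<xi> in lborel. (\<lambda>n. W n \<xi>) \<longlonglongrightarrow> (cmod (fourier_integral f \<xi>))\<^sup>2"
  proof (rule AE_I2)
    fix \<xi> :: 'a
    have "(\<lambda>n. W n \<xi>) \<longlonglongrightarrow> exp (- (norm (0 *\<^sub>R \<xi>))\<^sup>2 / 2) * (cmod (fourier_integral f \<xi>))\<^sup>2"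
      unfolding W_def gauss_def by (intro tendsto_intros e0) auto
    then show "(\<lambda>n. W n \<xi>) \<longlonglongrightarrow> (cmod (fourier_integral f \<xi>))\<^sup>2" by simp
  qed
  ultimately have "integrable lborel (\<lambda>\<xi>. (cmod (fourier_integral f \<xi>))\<^sup>2)"
      "(LINT \<xi>|lborel. (cmod (fourier_integral f \<xi>))\<^sup>2) = (l2_norm f)\<^sup>2"
    using integral_monotone_convergence_nonneg[OF W_int, where u="\<lambda>\<xi>. (cmod (fourier_integral f \<xi>))\<^sup>2" and x="(l2_norm f)\<^sup>2"]
    by (auto simp: W_def)
  then show "fourier_integral f \<in> sq_integrable" "l2_norm (fourier_integral f) = l2_norm f"
    by (simp_all add: sq_integrable_def l2_norm_def[of "fourier_integral f"])
qed


section \<open>The Fourier transform on square-integrable functions\<close>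

lemma fourier_integral_add_scale:
  assumes "integrable lborel f" "integrable lborel g"
  shows "fourier_integral (\<lambda>x. f x + c * g x) \<xi> = fourier_integral f \<xi> + c * fourier_integral g \<xi>"
proof -
  have "integrable lborel (\<lambda>x. f x * cis (- 2 * pi * (x \<bullet> \<xi>)))"
    "integrable lborel (\<lambda>x. g x * cis (- 2 * pi * (x \<bullet> \<xi>)))"
    by (rule integrable_mult_cis[OF assms(1)], rule integrable_mult_cis[OF assms(2)])
  then show ?thesis
    by (simp add: fourier_integral_def distrib_right mult.assoc)
qed

lemma l2_norm_fourier_integral_diff:
  assumes f: "integrable lborel f" "f \<in> sq_integrable" and g: "integrable lborel g" "g \<in> sq_integrable"
  shows "l2_norm (\<lambda>\<xi>. fourier_integral f \<xi> - fourier_integral g \<xi>) = l2_norm (\<lambda>x. f x - g x)"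
proof -
  have "fourier_integral (\<lambda>x. f x - g x) = (\<lambda>\<xi>. fourier_integral f \<xi> - fourier_integral g \<xi>)"
    using fourier_integral_add_scale[OF f(1) g(1), of "- 1"] by (intro ext) simp
  then show ?thesis
    using Plancherel(2)[of "\<lambda>x. f x - g x"] f g by (simp add: sq_integrable_diff)
qed

lemma fourier_integral_translate:
  assumes [measurable]: "f \<in> borel_measurable borel"
  shows "fourier_integral (\<lambda>x. f (x + a)) \<xi> = cis (2 * pi * (a \<bullet> \<xi>)) * fourier_integral f \<xi>"
proof -
  have "(LINT x|lborel. f (x + a) * cis (- 2 * pi * (x \<bullet> \<xi>)))
      = (LINT x|lborel. f (x + a) * cis (- 2 * pi * ((x + a - a) \<bullet> \<xi>)))" by simp
  also have "\<dots> = (LINT x|lborel. f x * cis (- 2 * pi * ((x - a) \<bullet> \<xi>)))"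
    by (rule integral_translate) measurable
  also have "\<dots> = (LINT x|lborel. cis (2 * pi * (a \<bullet> \<xi>)) * (f x * cis (- 2 * pi * (x \<bullet> \<xi>))))"
  proof (intro Bochner_Integration.integral_cong refl)
    fix x
    have "- 2 * pi * ((x - a) \<bullet> \<xi>) = 2 * pi * (a \<bullet> \<xi>) + - 2 * pi * (x \<bullet> \<xi>)"
      by (simp add: inner_diff_left algebra_simps)
    then show "f x * cis (- 2 * pi * ((x - a) \<bullet> \<xi>)) = cis (2 * pi * (a \<bullet> \<xi>)) * (f x * cis (- 2 * pi * (x \<bullet> \<xi>)))"
      by (simp only: cis_mult[symmetric] mult_ac)
  qed
  finally show ?thesis by (simp add: fourier_integral_def)
qed

text \<open>Truncate to balls: the truncation is a product of two square-integrable functions, the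
  indicator of a ball and \<open>f\<close>, hence integrable.\<close>

lemma integrable_dense_l2:
  fixes f :: "'a::euclidean_space \<Rightarrow> complex"
  assumes f: "f \<in> sq_integrable"
  obtains F where "\<And>n. integrable lborel (F n)" "\<And>n. F n \<in> sq_integrable"
    "(\<lambda>n::nat. l2_norm (\<lambda>x. F n x - f x)) \<longlonglongrightarrow> 0"
proof -
  note [measurable] = sq_integrableD(1)[OF f]
  define F where "F n x = indicator (ball 0 (real n)) x * f x" for n x
  have m: "F n \<in> borel_measurable borel" for n
    unfolding F_def[abs_def] by (intro borel_measurable_times borel_measurable_indicator) auto
  have b: "cmod (F n x) \<le> 1 * cmod (f x)" for n x
    by (auto simp: F_def norm_mult split: split_indicator)
  have lim: "(\<lambda>n. F n x) \<longlonglongrightarrow> f x" for x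
  proof (rule Lim_transform_eventually[OF tendsto_const])
    obtain N :: nat where "norm x < real N" using reals_Archimedean2 by blast
    then show "\<forall>\<^sub>F n in sequentially. f x = F n x"
      unfolding eventually_sequentially by (intro exI[of _ N]) (auto simp: F_def)
  qed
  have "integrable lborel (F n)" for n
    unfolding F_def[abs_def] using f emeasure_lborel_ball_finite[of 0 "real n"]
    by (intro sq_integrable_integrable_mult sq_integrable_indicator) auto
  with l2_dominated_convergence[OF f m b lim] show ?thesis by (intro that)
qed

lemma l2_convergent_imp_Cauchy:
  assumes F: "\<And>n. F n \<in> sq_integrable" and f: "f \<in> sq_integrable"
    and lim: "(\<lambda>n. l2_norm (\<lambda>x. F n x - f x)) \<longlonglongrightarrow> 0" and e: "e > 0"
  shows "\<exists>N. \<forall>m\<ge>N. \<forall>n\<ge>N. l2_norm (\<lambda>x. F m x - F n x) < e"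
proof -
  obtain N where N: "\<And>n. n \<ge> N \<Longrightarrow> l2_norm (\<lambda>x. F n x - f x) < e / 2"
    using LIMSEQ_D[OF lim, of "e / 2"] e by fastforce
  have "l2_norm (\<lambda>x. F m x - F n x) < e" if "m \<ge> N" "n \<ge> N" for m n
    using l2_norm_triangle_diff[OF F f F, of m n] N[OF that(1)] N[OF that(2)]
      l2_norm_minus_commute[of f "F n"] by simp
  then show ?thesis by blast
qed

text \<open>Plancherel turns a Cauchy sequence of integrable approximants into a Cauchy sequence of
  transforms, and completeness supplies the limit.\<close>

lemma has_fourier_L2_exists:
  assumes f: "f \<in> sq_integrable" shows "\<exists>g. has_fourier_L2 f g"
proof -
  obtain F where F: "\<And>n. integrable lborel (F n)" "\<And>n. F n \<in> sq_integrable"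
    "(\<lambda>n::nat. l2_norm (\<lambda>x. F n x - f x)) \<longlonglongrightarrow> 0"
    using integrable_dense_l2[OF f] by blast
  have "\<exists>g\<in>sq_integrable. (\<lambda>n. l2_norm (\<lambda>\<xi>. fourier_integral (F n) \<xi> - g \<xi>)) \<longlonglongrightarrow> 0"
    using l2_convergent_imp_Cauchy[OF F(2) f F(3)]
    by (intro l2_complete Plancherel F) (simp add: l2_norm_fourier_integral_diff F)
  then show ?thesis
    unfolding has_fourier_L2_def using F f Plancherel(1) by blast
qed

lemma integrable_bounded_sq_integrable:
  assumes f: "integrable lborel f" and b: "\<And>x. cmod (f x) \<le> C"
  shows "f \<in> sq_integrable"
proof -
  have [measurable]: "f \<in> borel_measurable borel"
    using borel_measurable_integrable[OF f] by simp
  have "integrable lborel (\<lambda>x. (cmod (f x))\<^sup>2)"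
  proof (rule Bochner_Integration.integrable_bound)
    show "integrable lborel (\<lambda>x. C * cmod (f x))" using f by simp
    show "AE x in lborel. norm ((cmod (f x))\<^sup>2) \<le> norm (C * cmod (f x))"
      using b by (intro AE_I2) (auto simp: power2_eq_square abs_mult intro!: mult_right_mono order_trans[OF b abs_ge_self])
  qed measurable
  then show ?thesis by (simp add: sq_integrable_def)
qed

text \<open>After replacing \<open>g\<close> by an integrable \<open>h\<close>, a Gaussian smoothing
  of \<open>h\<close> is close to \<open>h\<close> and is the transform of its damped inverse
  Fourier integral. That function is integrable and bounded, hence admissible.\<close>

lemma fourier_integral_dense:
  fixes g :: "'a::euclidean_space \<Rightarrow> complex"
  assumes g: "g \<in> sq_integrable" and d: "d > 0"
  shows "\<exists>F. integrable lborel F \<and> F \<in> sq_integrable \<and>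
    l2_norm (\<lambda>\<xi>. fourier_integral F \<xi> - g \<xi>) < d"
proof -
  obtain H where H: "\<And>n. integrable lborel (H n)" "\<And>n. H n \<in> sq_integrable"
    "(\<lambda>n::nat. l2_norm (\<lambda>x. H n x - g x)) \<longlonglongrightarrow> 0"
    using integrable_dense_l2[OF g] by blast
  obtain n where n: "l2_norm (\<lambda>x. H n x - g x) < d / 2"
    using LIMSEQ_D[OF H(3), of "d / 2"] d by fastforce
  define h where "h = H n"
  have h: "integrable lborel h" "h \<in> sq_integrable" by (simp_all add: h_def H)
  have [measurable]: "h \<in> borel_measurable borel" by (rule sq_integrableD(1)[OF h(2)])
  define e where "e n = 1 / real (Suc n)" for n
  have e: "e n > 0" for n by (simp add: e_def)
  have e0: "e \<longlonglongrightarrow> 0" unfolding e_def[abs_def] by (rule LIMSEQ_Suc[OF lim_1_over_n])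
  note smooth = gauss_smooth_l2[OF h less_imp_neq[OF e, symmetric] e0]
  have "\<forall>\<^sub>F k in sequentially. l2_norm (\<lambda>x. gauss_smooth (e k) h x - h x) < d / 2"
    using order_tendstoD(2)[OF smooth(2), of "d / 2"] d by simp
  \<comment> \<open>One index must serve both conditions, since smoothings are square-integrable
    only eventually.\<close>
  from eventually_happens'[OF sequentially_bot eventually_conj[OF this smooth(1)]]
  obtain k where k: "l2_norm (\<lambda>x. gauss_smooth (e k) h x - h x) < d / 2" "gauss_smooth (e k) h \<in> sq_integrable"
    by blast
  define P where "P \<xi> = (LINT \<eta>|lborel. h \<eta> * cis (2 * pi * (\<eta> \<bullet> \<xi>)))" for \<xi>
  have P [measurable]: "P \<in> borel_measurable borel"
    unfolding P_def[abs_def] by (rule measurable_integral_cis) measurable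
  define C where "C = (LINT x|lborel. cmod (h x))"
  have C: "cmod (P \<xi>) \<le> C" for \<xi> unfolding P_def C_def by (rule norm_integral_cis_le)
  define F where "F \<xi> = complex_of_real (gauss (e k *\<^sub>R \<xi>)) * P \<xi>" for \<xi>
  have F_int: "integrable lborel F"
    unfolding F_def[abs_def] using e[of k] C by (intro integrable_gauss_scaled_bounded[of P C]) auto
  have F_bound: "cmod (F \<xi>) \<le> C" for \<xi>
  proof -
    have "gauss (e k *\<^sub>R \<xi>) * cmod (P \<xi>) \<le> 1 * C"
      by (intro mult_mono C) (auto simp: gauss_def)
    then show ?thesis by (simp add: F_def norm_mult)
  qed
  have FT: "fourier_integral F = gauss_smooth (e k) h"
    unfolding F_def[abs_def] P_def using fourier_integral_gauss_damped[OF h(1) e] by (intro ext)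
  have "l2_norm (\<lambda>\<xi>. fourier_integral F \<xi> - g \<xi>) \<le> l2_norm (\<lambda>x. gauss_smooth (e k) h x - h x) + l2_norm (\<lambda>x. h x - g x)"
    unfolding FT by (intro l2_norm_triangle_diff k h g)
  also have "\<dots> < d" using k n by (simp add: h_def)
  finally show ?thesis
    using F_int integrable_bounded_sq_integrable[OF F_int F_bound] by blast
qed

text \<open>The isometry is used backwards: transforms converging to \<open>g\<close> are Cauchy,
  hence so are the functions themselves. This justifies the choice in
  \<open>inverse_fourier_L2\<close>.\<close>

lemma has_fourier_L2_surj:
  assumes g: "g \<in> sq_integrable" shows "\<exists>f. has_fourier_L2 f g"
proof -
  have "\<forall>n. \<exists>F. integrable lborel F \<and> F \<in> sq_integrable \<and>
      l2_norm (\<lambda>\<xi>. fourier_integral F \<xi> - g \<xi>) < 1 / real (Suc n)"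
    using fourier_integral_dense[OF g] by simp
  then obtain F where F: "\<And>n. integrable lborel (F n)" "\<And>n. F n \<in> sq_integrable"
    "\<And>n. l2_norm (\<lambda>\<xi>. fourier_integral (F n) \<xi> - g \<xi>) < 1 / real (Suc n)"
    by metis
  have lim: "(\<lambda>n. l2_norm (\<lambda>\<xi>. fourier_integral (F n) \<xi> - g \<xi>)) \<longlonglongrightarrow> 0"
  proof (rule Lim_null_comparison[OF _ LIMSEQ_Suc[OF lim_1_over_n]])
    show "\<forall>\<^sub>F n in sequentially. norm (l2_norm (\<lambda>\<xi>. fourier_integral (F n) \<xi> - g \<xi>)) \<le> 1 / real (Suc n)"
      using F(3) by (intro always_eventually allI) (simp add: less_imp_le)
  qed
  have "\<exists>f\<in>sq_integrable. (\<lambda>n. l2_norm (\<lambda>x. F n x - f x)) \<longlonglongrightarrow> 0"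
    using l2_convergent_imp_Cauchy[OF Plancherel(1)[OF F(1,2)] g lim]
    by (intro l2_complete F) (simp add: l2_norm_fourier_integral_diff F)
  then show ?thesis
    unfolding has_fourier_L2_def using F g lim Plancherel(1) by blast
qed

section \<open>The transform relation: isometry, linearity, translations\<close>

lemma has_fourier_L2D:
  assumes "has_fourier_L2 f g"
  shows "f \<in> sq_integrable" "g \<in> sq_integrable"
  using assms by (auto simp: has_fourier_L2_def)

lemma has_fourier_L2_norm:
  assumes "has_fourier_L2 f g" shows "l2_norm f = l2_norm g"
proof -
  obtain F where F: "\<And>n. F n \<in> sq_integrable" "\<And>n. integrable lborel (F n)"
      "\<And>n. fourier_integral (F n) \<in> sq_integrable"
      "(\<lambda>n::nat. l2_norm (\<lambda>x. F n x - f x)) \<longlonglongrightarrow> 0"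
      "(\<lambda>n. l2_norm (\<lambda>\<xi>. fourier_integral (F n) \<xi> - g \<xi>)) \<longlonglongrightarrow> 0"
    using assms by (auto simp: has_fourier_L2_def)
  note L = has_fourier_L2D[OF assms]
  have "(\<lambda>n. l2_norm (F n)) \<longlonglongrightarrow> l2_norm f" by (rule tendsto_l2_norm[OF F(1) L(1) F(4)])
  moreover have "(\<lambda>n. l2_norm (F n)) \<longlonglongrightarrow> l2_norm g"
    using tendsto_l2_norm[OF F(3) L(2) F(5)] by (simp add: Plancherel(2) F)
  ultimately show ?thesis by (rule LIMSEQ_unique)
qed

lemma has_fourier_L2_add_scale:
  assumes "has_fourier_L2 f g" "has_fourier_L2 f' g'"
  shows "has_fourier_L2 (\<lambda>x. f x + c * f' x) (\<lambda>\<xi>. g \<xi> + c * g' \<xi>)"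
proof -
  obtain F where F: "\<And>n. F n \<in> sq_integrable" "\<And>n. integrable lborel (F n)"
      "\<And>n. fourier_integral (F n) \<in> sq_integrable"
      "(\<lambda>n::nat. l2_norm (\<lambda>x. F n x - f x)) \<longlonglongrightarrow> 0"
      "(\<lambda>n. l2_norm (\<lambda>\<xi>. fourier_integral (F n) \<xi> - g \<xi>)) \<longlonglongrightarrow> 0"
    using assms(1) by (auto simp: has_fourier_L2_def)
  obtain F' where F': "\<And>n. F' n \<in> sq_integrable" "\<And>n. integrable lborel (F' n)"
      "\<And>n. fourier_integral (F' n) \<in> sq_integrable"
      "(\<lambda>n::nat. l2_norm (\<lambda>x. F' n x - f' x)) \<longlonglongrightarrow> 0"
      "(\<lambda>n. l2_norm (\<lambda>\<xi>. fourier_integral (F' n) \<xi> - g' \<xi>)) \<longlonglongrightarrow> 0"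
    using assms(2) by (auto simp: has_fourier_L2_def)
  note L = has_fourier_L2D[OF assms(1)] has_fourier_L2D[OF assms(2)]
  have lim: "(\<lambda>n. l2_norm (\<lambda>x. A n x + c * A' n x - (a x + c * a' x))) \<longlonglongrightarrow> 0"
    if A: "\<And>n. A n \<in> sq_integrable" "\<And>n. A' n \<in> sq_integrable" "a \<in> sq_integrable" "a' \<in> sq_integrable"
      "(\<lambda>n. l2_norm (\<lambda>x. A n x - a x)) \<longlonglongrightarrow> 0" "(\<lambda>n. l2_norm (\<lambda>x. A' n x - a' x)) \<longlonglongrightarrow> 0"
    for A A' :: "nat \<Rightarrow> 'a \<Rightarrow> complex" and a a'
  proof (rule Lim_null_comparison)
    show "(\<lambda>n. l2_norm (\<lambda>x. A n x - a x) + cmod c * l2_norm (\<lambda>x. A' n x - a' x)) \<longlonglongrightarrow> 0"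
      by (intro tendsto_add_zero tendsto_mult_right_zero A)
    have "l2_norm (\<lambda>x. (A n x - a x) + c * (A' n x - a' x))
        \<le> l2_norm (\<lambda>x. A n x - a x) + l2_norm (\<lambda>x. c * (A' n x - a' x))" for n
      by (intro l2_norm_triangle sq_integrable_scale sq_integrable_diff A)
    moreover have "(A n x - a x) + c * (A' n x - a' x) = A n x + c * A' n x - (a x + c * a' x)" for n x
      by (simp add: algebra_simps)
    ultimately show "\<forall>\<^sub>F n in sequentially. norm (l2_norm (\<lambda>x. A n x + c * A' n x - (a x + c * a' x)))
        \<le> l2_norm (\<lambda>x. A n x - a x) + cmod c * l2_norm (\<lambda>x. A' n x - a' x)"
      by (intro always_eventually) (simp add: l2_norm_scale)
  qed
  have FT: "fourier_integral (\<lambda>x. F n x + c * F' n x) = (\<lambda>\<xi>. fourier_integral (F n) \<xi> + c * fourier_integral (F' n) \<xi>)" for n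
    by (intro ext fourier_integral_add_scale F F')
  show ?thesis
    unfolding has_fourier_L2_def
  proof (intro conjI exI[of _ "\<lambda>n x. F n x + c * F' n x"] allI)
    show "(\<lambda>n. l2_norm (\<lambda>x. F n x + c * F' n x - (f x + c * f' x))) \<longlonglongrightarrow> 0"
      using F F' L by (intro lim)
    show "(\<lambda>n. l2_norm (\<lambda>\<xi>. fourier_integral (\<lambda>x. F n x + c * F' n x) \<xi> - (g \<xi> + c * g' \<xi>))) \<longlonglongrightarrow> 0"
      unfolding FT using F F' L by (intro lim)
    show "fourier_integral (\<lambda>x. F n x + c * F' n x) \<in> sq_integrable" for n
      unfolding FT using F F' by (intro sq_integrable_add sq_integrable_scale)
  qed (use F F' L in \<open>auto intro!: sq_integrable_add sq_integrable_scale\<close>)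
qed

text \<open>Parseval's identity by polarization of the norm equality; as a statement about the
  relation it applies to whichever representatives were chosen.\<close>

lemma has_fourier_L2_inner:
  assumes "has_fourier_L2 f g" "has_fourier_L2 f' g'"
  shows "l2_inner f f' = l2_inner g g'"
  using assms
  by (intro l2_inner_eqI has_fourier_L2_norm has_fourier_L2_add_scale) (auto dest: has_fourier_L2D)

text \<open>Translating by \<open>+a\<close> gives the modulation with positive sign that occurs in
  the atoms: the index \<open>m1\<close> corresponds to the translate of the generator by
  \<open>x + m1\<close>.\<close>

lemma has_fourier_L2_translate:
  assumes "has_fourier_L2 f g"
  shows "has_fourier_L2 (\<lambda>x. f (x + a)) (\<lambda>\<xi>. cis (2 * pi * (a \<bullet> \<xi>)) * g \<xi>)"
proof -
  obtain F where F: "\<And>n. F n \<in> sq_integrable" "\<And>n. integrable lborel (F n)"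
      "\<And>n. fourier_integral (F n) \<in> sq_integrable"
      "(\<lambda>n::nat. l2_norm (\<lambda>x. F n x - f x)) \<longlonglongrightarrow> 0"
      "(\<lambda>n. l2_norm (\<lambda>\<xi>. fourier_integral (F n) \<xi> - g \<xi>)) \<longlonglongrightarrow> 0"
    using assms by (auto simp: has_fourier_L2_def)
  note L = has_fourier_L2D[OF assms]
  note M = sq_integrableD(1)[OF F(1)]
  have int: "integrable lborel (\<lambda>x. F n (x + a))" for n
    using lborel_integrable_affine[OF M _ F(2), of 1 n a] by (simp add: add.commute)
  have cis_L2: "(\<lambda>\<xi>. cis (2 * pi * (a \<bullet> \<xi>)) * h \<xi>) \<in> sq_integrable"
    "l2_norm (\<lambda>\<xi>. cis (2 * pi * (a \<bullet> \<xi>)) * h \<xi>) = l2_norm h"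
    if "h \<in> sq_integrable" for h
  proof -
    have [measurable]: "h \<in> borel_measurable borel" by (rule sq_integrableD(1)[OF that])
    have "(\<lambda>\<xi>. cis (2 * pi * (a \<bullet> \<xi>)) * h \<xi>) \<in> borel_measurable borel" by measurable
    then show "(\<lambda>\<xi>. cis (2 * pi * (a \<bullet> \<xi>)) * h \<xi>) \<in> sq_integrable"
      using that by (simp add: sq_integrable_def norm_mult)
    show "l2_norm (\<lambda>\<xi>. cis (2 * pi * (a \<bullet> \<xi>)) * h \<xi>) = l2_norm h"
      by (simp add: l2_norm_def norm_mult)
  qed
  have FT: "fourier_integral (\<lambda>x. F n (x + a)) = (\<lambda>\<xi>. cis (2 * pi * (a \<bullet> \<xi>)) * fourier_integral (F n) \<xi>)" for n
    using fourier_integral_translate[OF M] by (intro ext)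
  show ?thesis
    unfolding has_fourier_L2_def
  proof (intro conjI exI[of _ "\<lambda>n x. F n (x + a)"] allI)
    have "l2_norm (\<lambda>x. F n (x + a) - f (x + a)) = l2_norm (\<lambda>x. F n x - f x)" for n
      using l2_norm_translate[OF sq_integrableD(1)[OF sq_integrable_diff[OF F(1) L(1)]]] .
    then show "(\<lambda>n. l2_norm (\<lambda>x. F n (x + a) - f (x + a))) \<longlonglongrightarrow> 0" using F(4) by simp
    have "l2_norm (\<lambda>\<xi>. cis (2 * pi * (a \<bullet> \<xi>)) * fourier_integral (F n) \<xi> - cis (2 * pi * (a \<bullet> \<xi>)) * g \<xi>)
        = l2_norm (\<lambda>\<xi>. fourier_integral (F n) \<xi> - g \<xi>)" for n
      using cis_L2(2)[OF sq_integrable_diff[OF F(3) L(2)]] by (simp only: right_diff_distrib)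
    then show "(\<lambda>n. l2_norm (\<lambda>\<xi>. fourier_integral (\<lambda>x. F n (x + a)) \<xi> - cis (2 * pi * (a \<bullet> \<xi>)) * g \<xi>)) \<longlonglongrightarrow> 0"
      unfolding FT using F(5) by simp
    show "fourier_integral (\<lambda>x. F n (x + a)) \<in> sq_integrable" for n
      unfolding FT by (intro cis_L2 F)
  qed (use F L in \<open>auto intro!: sq_integrable_translate cis_L2 int\<close>)
qed

lemma has_fourier_L2_fourier_L2:
  assumes "f \<in> sq_integrable" shows "has_fourier_L2 f (fourier_L2 f)"
  unfolding fourier_L2_def using has_fourier_L2_exists[OF assms] by (rule someI_ex)

lemma has_fourier_L2_inverse_fourier_L2:
  assumes "g \<in> sq_integrable" shows "has_fourier_L2 (inverse_fourier_L2 g) g"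
  unfolding inverse_fourier_L2_def using has_fourier_L2_surj[OF assms] by (rule someI_ex)


section \<open>Tight frames for closed spans\<close>

text \<open>Finite sums of nonnegative terms increase with the index set, so the infinite sum is
  their supremum.\<close>

lemma has_sum_nonneg_realI:
  fixes f :: "'i \<Rightarrow> real"
  assumes "\<And>i. i \<in> A \<Longrightarrow> 0 \<le> f i"
    and upper: "\<And>K. finite K \<Longrightarrow> K \<subseteq> A \<Longrightarrow> sum f K \<le> S"
    and lower: "\<And>e. e > 0 \<Longrightarrow> \<exists>K. finite K \<and> K \<subseteq> A \<and> S - e \<le> sum f K"
  shows "(f has_sum S) A"
  unfolding has_sum_def
proof (rule order_tendstoI)
  fix a assume "a < S"
  then obtain K where K: "finite K" "K \<subseteq> A" "a < sum f K"
    using lower[of "(S - a) / 2"] by (auto simp: field_simps)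
  show "\<forall>\<^sub>F X in finite_subsets_at_top A. a < sum f X"
    unfolding eventually_finite_subsets_at_top
    using K assms(1)
    by (intro exI[of _ K]) (auto intro!: less_le_trans[OF K(3)] sum_mono2)
next
  fix a assume "S < a"
  then show "\<forall>\<^sub>F X in finite_subsets_at_top A. sum f X < a"
    unfolding eventually_finite_subsets_at_top
    using upper by (intro exI[of _ "{}"]) (auto intro: le_less_trans)
qed

text \<open>Analysis operators extend by continuity, so the frame identity need only be checked on
  finite linear combinations.\<close>

lemma tight_frame_closed_spanI:
  fixes u :: "'i \<Rightarrow> 'a::euclidean_space \<Rightarrow> complex"
  assumes u: "\<And>i. i \<in> J \<Longrightarrow> u i \<in> sq_integrable" and a: "0 \<le> a"
    and span: "\<And>F c. finite F \<Longrightarrow> F \<subseteq> J \<Longrightarrow>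
      ((\<lambda>j. (cmod (l2_inner (\<lambda>x. \<Sum>i\<in>F. c i * u i x) (u j)))\<^sup>2) has_sum
         a * (l2_norm (\<lambda>x. \<Sum>i\<in>F. c i * u i x))\<^sup>2) J"
  shows "tight_frame a u J (closed_span u J)"
proof -
  \<comment> \<open>The length of a finite section of the coefficient family. It is subadditive in
    f, and for fixed finite K bounded by a multiple of the norm of f, however crude.\<close>
  define A where "A f K = L2_set (\<lambda>j. cmod (l2_inner f (u j))) K" for f K
  have A_sq: "(A f K)\<^sup>2 = (\<Sum>j\<in>K. (cmod (l2_inner f (u j)))\<^sup>2)" for f K
    by (simp add: A_def L2_set_def sum_nonneg)
  have A_nonneg: "0 \<le> A f K" for f K by (simp add: A_def)
  have A_add: "A f K \<le> A g K + A (\<lambda>x. f x - g x) K"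
    if "f \<in> sq_integrable" "g \<in> sq_integrable" "K \<subseteq> J" for f g K
  proof -
    have "A f K \<le> L2_set (\<lambda>j. cmod (l2_inner g (u j)) + cmod (l2_inner (\<lambda>x. f x - g x) (u j))) K"
      unfolding A_def
    proof (intro L2_set_mono)
      fix j assume "j \<in> K"
      then have "l2_inner f (u j) = l2_inner g (u j) + l2_inner (\<lambda>x. f x - g x) (u j)"
        using that u by (simp add: l2_inner_diff_left subset_iff)
      then show "cmod (l2_inner f (u j)) \<le> cmod (l2_inner g (u j)) + cmod (l2_inner (\<lambda>x. f x - g x) (u j))"
        by (simp add: norm_triangle_ineq)
    qed simp
    also have "\<dots> \<le> A g K + A (\<lambda>x. f x - g x) K"
      unfolding A_def by (rule L2_set_triangle_ineq)
    finally show ?thesis .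
  qed
  have A_finite: "A f K \<le> l2_norm f * (\<Sum>j\<in>K. l2_norm (u j))"
    if "f \<in> sq_integrable" "K \<subseteq> J" for f K
  proof -
    have "A f K \<le> (\<Sum>j\<in>K. cmod (l2_inner f (u j)))"
      unfolding A_def by (rule L2_set_le_sum) auto
    also have "\<dots> \<le> (\<Sum>j\<in>K. l2_norm f * l2_norm (u j))"
      using that u by (intro sum_mono l2_Cauchy_Schwarz) auto
    finally show ?thesis by (simp add: sum_distrib_left)
  qed
  define S where "S = {s. \<exists>F c. finite F \<and> F \<subseteq> J \<and> s = (\<lambda>x. \<Sum>i\<in>F. c i * u i x)}"
  have S_L2: "s \<in> sq_integrable" if "s \<in> S" for s
    using that u by (auto simp: S_def intro!: sq_integrable_sum sq_integrable_scale)
  have S_sum: "((\<lambda>j. (cmod (l2_inner s (u j)))\<^sup>2) has_sum a * (l2_norm s)\<^sup>2) J" if "s \<in> S" for s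
    using that span by (auto simp: S_def)
  have approx: "\<exists>s\<in>S. l2_norm (\<lambda>x. f x - s x) < e" if "f \<in> closed_span u J" "e > 0" for f e
  proof -
    from that obtain F c where "finite F" "F \<subseteq> J" "l2_norm (\<lambda>x. f x - (\<Sum>i\<in>F. c i * u i x)) < e"
      unfolding closed_span_def by auto
    then show ?thesis
      unfolding S_def by (intro bexI[of _ "\<lambda>x. \<Sum>i\<in>F. c i * u i x"] CollectI exI[of _ F] exI[of _ c]) auto
  qed
  have S_upper: "A s K \<le> sqrt a * l2_norm s" if "s \<in> S" "finite K" "K \<subseteq> J" for s K
  proof -
    have "(A s K)\<^sup>2 \<le> a * (l2_norm s)\<^sup>2"
      unfolding A_sq using S_sum[OF that(1)] that by (intro finite_sum_le_has_sum) auto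
    also have "\<dots> = (sqrt a * l2_norm s)\<^sup>2" using a by (simp add: power_mult_distrib)
    finally show ?thesis by (rule power2_le_imp_le) (simp add: a)
  qed
  \<comment> \<open>Approximability by \<open>S\<close> is the hypothesis, in place of membership in
    the closed span, because the bound is later needed for a difference s - f. The crude constant
    depends on K but disappears in the limit.\<close>
  have upper: "A f K \<le> sqrt a * l2_norm f"
    if f: "f \<in> sq_integrable" and app: "\<And>e. e > 0 \<Longrightarrow> \<exists>s\<in>S. l2_norm (\<lambda>x. f x - s x) < e"
      and K: "finite K" "K \<subseteq> J" for f K
  proof (rule field_le_epsilon)
    fix e :: real assume e: "e > 0"
    \<comment> \<open>The first two terms collect the two errors caused by replacing f with s; the 1
      ensures positivity.\<close>
    define C where "C = sqrt a + (\<Sum>j\<in>K. l2_norm (u j)) + 1"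
    have C: "C > 0" using a by (auto simp: C_def intro!: add_nonneg_pos add_nonneg_nonneg sum_nonneg)
    obtain s where s: "s \<in> S" "l2_norm (\<lambda>x. f x - s x) < e / C"
      using app[of "e / C"] e C by auto
    have "A f K \<le> A s K + A (\<lambda>x. f x - s x) K"
      using f S_L2[OF s(1)] K by (intro A_add)
    also have "\<dots> \<le> sqrt a * l2_norm s + l2_norm (\<lambda>x. f x - s x) * (\<Sum>j\<in>K. l2_norm (u j))"
      using S_upper[OF s(1) K] A_finite[OF sq_integrable_diff[OF f S_L2[OF s(1)]] K(2)] by simp
    also have "\<dots> \<le> sqrt a * (l2_norm f + l2_norm (\<lambda>x. f x - s x)) + l2_norm (\<lambda>x. f x - s x) * (\<Sum>j\<in>K. l2_norm (u j))"
      using l2_norm_diff_abs[OF f S_L2[OF s(1)]] a by (intro add_right_mono mult_left_mono) auto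
    also have "\<dots> \<le> sqrt a * l2_norm f + l2_norm (\<lambda>x. f x - s x) * C"
      by (simp add: C_def algebra_simps)
    also have "l2_norm (\<lambda>x. f x - s x) * C \<le> e"
      using s(2) C by (simp add: field_simps)
    finally show "A f K \<le> sqrt a * l2_norm f + e" by simp
  qed
  have "((\<lambda>j. (cmod (l2_inner f (u j)))\<^sup>2) has_sum a * (l2_norm f)\<^sup>2) J"
    if f: "f \<in> closed_span u J" for f
  proof (rule has_sum_nonneg_realI)
    have fL: "f \<in> sq_integrable" using f by (simp add: closed_span_def)
    fix K assume K: "finite K" "K \<subseteq> J"
    have "(A f K)\<^sup>2 \<le> (sqrt a * l2_norm f)\<^sup>2"
      using upper[OF fL approx[OF f] K] A_nonneg by (intro power_mono) auto
    then show "(\<Sum>j\<in>K. (cmod (l2_inner f (u j)))\<^sup>2) \<le> a * (l2_norm f)\<^sup>2"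
      using a by (simp add: A_sq power_mult_distrib)
  next
    have fL: "f \<in> sq_integrable" using f by (simp add: closed_span_def)
    fix e :: real assume e: "e > 0"
    \<comment> \<open>One sqrt a pays for exchanging the norms of f and s, one for the coefficients
      of s - f, and the 1 for truncating the sum of s.\<close>
    define D where "D = 2 * sqrt a + 1"
    have D: "D > 0" using a by (simp add: D_def add_nonneg_pos)
    have lower: "\<exists>K. finite K \<and> K \<subseteq> J \<and> sqrt a * l2_norm f - d \<le> A f K" if d: "d > 0" for d
    proof -
      obtain s where s: "s \<in> S" "l2_norm (\<lambda>x. f x - s x) < d / D"
        using approx[OF f, of "d / D"] d D by auto
      have sL: "s \<in> sq_integrable" by (rule S_L2) fact
      have dD: "d / D > 0" using d D by simp
      obtain K where K: "finite K" "K \<subseteq> J"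
        "dist (\<Sum>j\<in>K. (cmod (l2_inner s (u j)))\<^sup>2) (a * (l2_norm s)\<^sup>2) \<le> (d / D)\<^sup>2"
        using has_sum_finite_approximation[OF S_sum[OF s(1)], of "(d / D)\<^sup>2"]
          zero_less_power[OF dD, of 2] by blast
      have "(sqrt a * l2_norm s)\<^sup>2 \<le> (A s K)\<^sup>2 + (d / D)\<^sup>2"
        using K(3) a by (simp add: A_sq dist_real_def power_mult_distrib)
      also have "\<dots> \<le> (A s K + d / D)\<^sup>2"
        using mult_nonneg_nonneg[OF A_nonneg[of s K] less_imp_le[OF dD]] by (simp add: power2_sum)
      finally have 1: "sqrt a * l2_norm s \<le> A s K + d / D"
        by (rule power2_le_imp_le) (use A_nonneg[of s K] dD in simp)
      have 2: "A s K \<le> A f K + A (\<lambda>x. s x - f x) K"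
        using fL sL K by (intro A_add)
      have 3: "A (\<lambda>x. s x - f x) K \<le> sqrt a * l2_norm (\<lambda>x. s x - f x)"
      proof (rule upper)
        fix r :: real assume r: "r > 0"
        then obtain t where t: "t \<in> S" "l2_norm (\<lambda>x. f x - t x) < r" using approx[OF f] by blast
        have "(\<lambda>x. s x - t x) \<in> S"
        proof -
          obtain F c where F: "finite F" "F \<subseteq> J" "s = (\<lambda>x. \<Sum>i\<in>F. c i * u i x)"
            using s(1) by (auto simp: S_def)
          obtain G d where G: "finite G" "G \<subseteq> J" "t = (\<lambda>x. \<Sum>i\<in>G. d i * u i x)"
            using t(1) by (auto simp: S_def)
          let ?c = "\<lambda>i. (if i \<in> F then c i else 0) - (if i \<in> G then d i else 0)"
          have "(\<Sum>i\<in>F \<union> G. ?c i * u i x) = s x - t x" for x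
          proof -
            have "(\<Sum>i\<in>F \<union> G. ?c i * u i x)
              = (\<Sum>i\<in>F \<union> G. if i \<in> F then c i * u i x else 0) - (\<Sum>i\<in>F \<union> G. if i \<in> G then d i * u i x else 0)"
              by (subst sum_subtractf[symmetric]) (auto intro!: sum.cong simp: algebra_simps)
            also have "\<dots> = (\<Sum>i\<in>F. c i * u i x) - (\<Sum>i\<in>G. d i * u i x)"
              using F(1) G(1) by (simp add: sum.inter_restrict[symmetric] Int_absorb1)
            finally show ?thesis by (simp add: F G)
          qed
          then show ?thesis
            unfolding S_def using F G by (intro CollectI exI[of _ "F \<union> G"] exI[of _ ?c]) auto
        qed
        moreover have "l2_norm (\<lambda>x. s x - f x - (s x - t x)) < r"
          using t(2) l2_norm_minus_commute[of t f] by simp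
        ultimately show "\<exists>t\<in>S. l2_norm (\<lambda>x. s x - f x - t x) < r"
          by (intro bexI[of _ "\<lambda>x. s x - t x"])
      qed (use fL sL K in auto)
      have 4: "l2_norm f \<le> l2_norm s + d / D"
        using l2_norm_diff_abs[OF fL sL] s(2) by simp
      have 5: "sqrt a * l2_norm (\<lambda>x. s x - f x) \<le> sqrt a * (d / D)"
        using s(2) l2_norm_minus_commute[of f s] a by (intro mult_left_mono) auto
      have "sqrt a * l2_norm f \<le> sqrt a * l2_norm s + sqrt a * (d / D)"
        using mult_left_mono[OF 4, of "sqrt a"] a by (simp add: algebra_simps)
      also have "\<dots> \<le> A f K + d / D * D"
      proof -
        have "d / D * D = 2 * (sqrt a * (d / D)) + d / D"
          by (subst (2) D_def) (simp add: algebra_simps)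
        then show ?thesis using 1 2 3 5 by linarith
      qed
      finally have "sqrt a * l2_norm f - d \<le> A f K" using D by simp
      with K show ?thesis by blast
    qed
    define N where "N = sqrt a * l2_norm f"
    have N: "0 \<le> N" "N\<^sup>2 = a * (l2_norm f)\<^sup>2" using a by (auto simp: N_def power_mult_distrib)
    show "\<exists>K. finite K \<and> K \<subseteq> J \<and> a * (l2_norm f)\<^sup>2 - e \<le> (\<Sum>j\<in>K. (cmod (l2_inner f (u j)))\<^sup>2)"
    proof -
      \<comment> \<open>Passing to squares multiplies the gap by N + A f K, which is at most 2 N
        when A f K is below N; the 1 avoids division by zero.\<close>
      obtain K where K: "finite K" "K \<subseteq> J" "N - e / (2 * N + 1) \<le> A f K"
        using lower[of "e / (2 * N + 1)"] e N by (auto simp: N_def)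
      have "N\<^sup>2 - e \<le> (A f K)\<^sup>2"
      proof (cases "N \<le> A f K")
        case True
        then show ?thesis using power_mono[OF True N(1), of 2] e by simp
      next
        case False
        have "N\<^sup>2 - (A f K)\<^sup>2 = (N - A f K) * (N + A f K)"
          by (simp add: power2_eq_square algebra_simps)
        also have "\<dots> \<le> e / (2 * N + 1) * (2 * N + 1)"
          using K(3) False N(1) A_nonneg[of f K] e by (intro mult_mono) auto
        also have "\<dots> = e" using N by (simp add: add_nonneg_eq_0_iff)
        finally show ?thesis by simp
      qed
      with K N show ?thesis by (auto simp: A_sq)
    qed
  qed simp
  moreover have "u i \<in> closed_span u J" if "i \<in> J" for i
    unfolding closed_span_def using that u
    by (auto intro!: exI[of _ "{i}"] exI[of _ "\<lambda>_. 1"])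
  ultimately show ?thesis by (simp add: tight_frame_def)
qed

text \<open>The hypothesis \<open>gram\<close> states that \<open>u\<close> has the Gram matrix of an orthonormal system, indexed by
  \<open>P\<close>, tensored with the frame \<open>g\<close>.\<close>

lemma tight_frame_tensor_gram:
  fixes u :: "'i \<Rightarrow> 'a::euclidean_space \<Rightarrow> complex" and g :: "'q \<Rightarrow> 'b::euclidean_space \<Rightarrow> complex"
  assumes u: "\<And>i. i \<in> J \<Longrightarrow> u i \<in> sq_integrable" and a: "0 \<le> a"
    and g: "tight_frame a g Q sq_integrable"
    and bij: "bij_betw (\<lambda>i. (p i, q i)) J (P \<times> Q)"
    and gram: "\<And>i i'. i \<in> J \<Longrightarrow> i' \<in> J \<Longrightarrow>
      l2_inner (u i) (u i') = (if p i = p i' then l2_inner (g (q i)) (g (q i')) else 0)"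
  shows "tight_frame a u J (closed_span u J)"
proof (rule tight_frame_closed_spanI[OF u a])
  fix F :: "'i set" and c :: "'i \<Rightarrow> complex"
  assume F: "finite F" "F \<subseteq> J"
  \<comment> \<open>Formally the combination is the sum over y of e_y tensored with
    \<open>G y\<close>, where the e_y are orthonormal; \<open>G y\<close> is its component at label
    y.\<close>
  define G where "G y = (\<lambda>x. \<Sum>i\<in>{i\<in>F. p i = y}. c i * g (q i) x)" for y
  define f where "f = (\<lambda>x. \<Sum>i\<in>F. c i * u i x)"
  have pq: "p i \<in> P" "q i \<in> Q" if "i \<in> J" for i
    using bij_betw_apply[OF bij that] by auto
  have gL: "g y \<in> sq_integrable" if "y \<in> Q" for y
    using g that by (auto simp: tight_frame_def)
  have GL: "G y \<in> sq_integrable" for y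
    unfolding G_def using F pq by (intro sq_integrable_sum sq_integrable_scale gL) auto
  have fL: "f \<in> sq_integrable"
    unfolding f_def using F u by (intro sq_integrable_sum sq_integrable_scale) auto
  \<comment> \<open>Testing against \<open>u j\<close> sees only the component with label
    \<open>p j\<close>.\<close>
  have inner_f: "l2_inner f (u j) = l2_inner (G (p j)) (g (q j))" if j: "j \<in> J" for j
  proof -
    have "l2_inner f (u j) = (\<Sum>i\<in>F. c i * l2_inner (u i) (u j))"
      unfolding f_def using F u j by (intro l2_inner_sum_left) auto
    also have "\<dots> = (\<Sum>i\<in>F. if p i = p j then c i * l2_inner (g (q i)) (g (q j)) else 0)"
      using F j by (intro sum.cong) (auto simp: gram)
    also have "\<dots> = (\<Sum>i\<in>{i\<in>F. p i = p j}. c i * l2_inner (g (q i)) (g (q j)))"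
      using F(1) by (simp add: sum.inter_filter)
    also have "\<dots> = l2_inner (G (p j)) (g (q j))"
      unfolding G_def using F pq j by (intro l2_inner_sum_left[symmetric] gL) auto
    finally show ?thesis .
  qed
  have norm_f: "(l2_norm f)\<^sup>2 = (\<Sum>y\<in>p ` F. (l2_norm (G y))\<^sup>2)"
  proof -
    have "l2_inner f f = (\<Sum>i\<in>F. cnj (c i) * l2_inner f (u i))"
      by (subst (2) f_def, rule l2_inner_sum_right) (use F u fL in auto)
    also have "\<dots> = (\<Sum>i\<in>F. cnj (c i) * l2_inner (G (p i)) (g (q i)))"
      using F by (intro sum.cong) (auto simp: inner_f)
    also have "\<dots> = (\<Sum>y\<in>p ` F. \<Sum>i\<in>{i\<in>F. p i = y}. cnj (c i) * l2_inner (G (p i)) (g (q i)))"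
      using F(1) by (intro sum.image_gen)
    also have "\<dots> = (\<Sum>y\<in>p ` F. l2_inner (G y) (G y))"
    proof (intro sum.cong refl)
      fix y
      have "l2_inner (G y) (G y) = (\<Sum>i\<in>{i\<in>F. p i = y}. cnj (c i) * l2_inner (G y) (g (q i)))"
        by (subst (2) G_def, rule l2_inner_sum_right) (use F GL pq gL in auto)
      then show "(\<Sum>i\<in>{i\<in>F. p i = y}. cnj (c i) * l2_inner (G (p i)) (g (q i))) = l2_inner (G y) (G y)"
        by simp
    qed
    finally show ?thesis
      by (simp add: l2_inner_self del: of_real_power flip: of_real_sum)
  qed
  have 1: "((\<lambda>z. (cmod (l2_inner (G y) (g z)))\<^sup>2) has_sum a * (l2_norm (G y))\<^sup>2) Q" for y
    using g GL by (auto simp: tight_frame_def)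
  have "((\<lambda>(y, z). (cmod (l2_inner (G y) (g z)))\<^sup>2) has_sum (\<Sum>y\<in>p ` F. a * (l2_norm (G y))\<^sup>2))
      (Sigma (p ` F) (\<lambda>_. Q))"
  proof (rule has_sum_SigmaI)
    show "((\<lambda>z. case (y, z) of (y, z) \<Rightarrow> (cmod (l2_inner (G y) (g z)))\<^sup>2) has_sum a * (l2_norm (G y))\<^sup>2) Q" for y
      using 1 by simp
    show "((\<lambda>y. a * (l2_norm (G y))\<^sup>2) has_sum (\<Sum>y\<in>p ` F. a * (l2_norm (G y))\<^sup>2)) (p ` F)"
      using F(1) by simp
    show "(\<lambda>(y, z). (cmod (l2_inner (G y) (g z)))\<^sup>2) summable_on Sigma (p ` F) (\<lambda>_. Q)"
      using F(1) 1 by (intro summable_on_SigmaI[where g="\<lambda>y. a * (l2_norm (G y))\<^sup>2"]) auto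
  qed
  also have "?this \<longleftrightarrow> ((\<lambda>(y, z). (cmod (l2_inner (G y) (g z)))\<^sup>2) has_sum a * (l2_norm f)\<^sup>2) (P \<times> Q)"
    unfolding norm_f sum_distrib_left
  proof (rule has_sum_cong_neutral)
    fix yz assume "yz \<in> P \<times> Q - Sigma (p ` F) (\<lambda>_. Q)"
    then obtain y z where yz: "yz = (y, z)" "y \<notin> p ` F" by auto
    then have "{i\<in>F. p i = y} = {}" by auto
    then have "G y = (\<lambda>_. 0)" by (simp only: G_def sum.empty)
    then show "(case yz of (y, z) \<Rightarrow> (cmod (l2_inner (G y) (g z)))\<^sup>2) = 0"
      by (simp add: yz l2_inner_def)
  qed (use F pq in auto)
  also have "\<dots> \<longleftrightarrow> ((\<lambda>j. (cmod (l2_inner (G (p j)) (g (q j))))\<^sup>2) has_sum a * (l2_norm f)\<^sup>2) J"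
    using has_sum_reindex_bij_betw[OF bij, of "\<lambda>(y, z). (cmod (l2_inner (G y) (g z)))\<^sup>2"] by simp
  also have "\<dots> \<longleftrightarrow> ((\<lambda>j. (cmod (l2_inner f (u j)))\<^sup>2) has_sum a * (l2_norm f)\<^sup>2) J"
    by (intro has_sum_cong) (simp add: inner_f)
  finally show "((\<lambda>j. (cmod (l2_inner (\<lambda>x. \<Sum>i\<in>F. c i * u i x) (u j)))\<^sup>2) has_sum
      a * (l2_norm (\<lambda>x. \<Sum>i\<in>F. c i * u i x))\<^sup>2) J"
    unfolding f_def .
qed


section \<open>The change of variables\<close>

lemma measurable_\<gamma>1 [measurable]: "\<gamma>1 \<in> borel_measurable borel"
  unfolding \<gamma>1_def borel_prod[symmetric] case_prod_beta by measurable

lemma measurable_\<gamma>2 [measurable]: "\<gamma>2 \<in> borel_measurable borel"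
  unfolding \<gamma>2_def borel_prod[symmetric] case_prod_beta by measurable

text \<open>The dependence of \<open>\<gamma>1\<close> on the first coordinate; the form t |t| / 2
  exhibits it as an odd function with derivative |t|.\<close>

definition half_sgn_sq :: "real \<Rightarrow> real" where
  "half_sgn_sq t = t * \<bar>t\<bar> / 2"

lemma half_sgn_sq_altdef: "half_sgn_sq t = 1/2 * sgn t * t\<^sup>2"
  by (auto simp: half_sgn_sq_def sgn_if power2_eq_square)

lemma measurable_half_sgn_sq [measurable]: "half_sgn_sq \<in> borel_measurable borel"
  unfolding half_sgn_sq_def[abs_def] by measurable

lemma DERIV_half_sgn_sq: "DERIV half_sgn_sq t :> \<bar>t\<bar>"
proof (cases "t = 0")
  case True
  have "((\<lambda>h. \<bar>h\<bar> / 2) \<longlongrightarrow> 0) (at (0::real))"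
    by (auto intro!: tendsto_eq_intros)
  then have "((\<lambda>h. (half_sgn_sq (0 + h) - half_sgn_sq 0) / h) \<longlongrightarrow> 0) (at 0)"
    by (rule Lim_transform_eventually) (auto simp: half_sgn_sq_def eventually_at_filter)
  then show ?thesis using True by (simp add: DERIV_def)
next
  case False
  \<comment> \<open>The open half-line containing t, where the function is a fixed multiple of the
    square.\<close>
  define U where "U = {x. sgn x = sgn t}"
  have "U = (if t > 0 then {0<..} else {..<0})"
    using False by (auto simp: U_def sgn_if split: if_splits)
  then have U: "open U" "t \<in> U" by (auto simp: U_def)
  have "DERIV (\<lambda>x. sgn t * x\<^sup>2 / 2) t :> \<bar>t\<bar>"
    by (auto intro!: derivative_eq_intros simp: sgn_if)
  then show ?thesis
    by (rule has_field_derivative_transform_within_open[OF _ U])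
      (auto simp: U_def half_sgn_sq_altdef)
qed

lemma strict_mono_half_sgn_sq: "strict_mono half_sgn_sq"
proof (rule strict_monoI)
  fix s t :: real assume st: "s < t"
  consider "0 \<le> s" | "t \<le> 0" | "s < 0" "0 < t" by linarith
  then show "half_sgn_sq s < half_sgn_sq t"
  proof cases
    case 1 then have "s\<^sup>2 < t\<^sup>2" using st by (intro power_strict_mono) auto
    with 1 st show ?thesis by (simp add: half_sgn_sq_def power2_eq_square)
  next
    case 2 then have "(-t)\<^sup>2 < (-s)\<^sup>2" using st by (intro power_strict_mono) auto
    with 2 st show ?thesis by (simp add: half_sgn_sq_def power2_eq_square)
  next
    case 3 then have "s * \<bar>s\<bar> < 0" "0 < t * \<bar>t\<bar>" by (simp_all add: mult_less_0_iff zero_less_mult_iff)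
    then show ?thesis by (simp add: half_sgn_sq_def)
  qed
qed

lemma surj_half_sgn_sq: "\<exists>t. half_sgn_sq t = u"
proof
  show "half_sgn_sq (sgn u * sqrt (2 * \<bar>u\<bar>)) = u"
    by (auto simp: half_sgn_sq_def sgn_if abs_mult)
qed

text \<open>An increasing bijection pulls an interval back to an interval, and by the fundamental
  theorem of calculus the weight |t|, being the derivative, gives it the original length.\<close>

lemma distr_half_sgn_sq:
  "distr (density lborel (\<lambda>t. ennreal \<bar>t\<bar>)) borel half_sgn_sq = (lborel :: real measure)"
proof (rule lborel_eqI[symmetric])
  fix l u :: real assume "\<And>b. b \<in> Basis \<Longrightarrow> l \<bullet> b \<le> u \<bullet> b"
  then have lu: "l \<le> u" by simp
  obtain p q where pq: "half_sgn_sq p = l" "half_sgn_sq q = u" using surj_half_sgn_sq by metis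
  have less: "half_sgn_sq s < half_sgn_sq t \<longleftrightarrow> s < t" for s t
    using strict_mono_less[OF strict_mono_half_sgn_sq] .
  have "p \<le> q" using lu pq less by (metis linorder_not_le)
  have "emeasure (distr (density lborel (\<lambda>t. ennreal \<bar>t\<bar>)) borel half_sgn_sq) (box l u)
      = (\<integral>\<^sup>+t. ennreal \<bar>t\<bar> * indicator (half_sgn_sq -` box l u) t \<partial>lborel)"
    using measurable_sets_borel[OF measurable_half_sgn_sq, of "box l u"]
    by (subst emeasure_distr) (simp_all add: emeasure_density del: box_real)
  also have "half_sgn_sq -` box l u = {p<..<q}"
    using pq less by (auto simp: box_real)
  \<comment> \<open>Passing to the closed interval for the fundamental theorem; endpoints are
    null.\<close>
  also have "(\<integral>\<^sup>+t. ennreal \<bar>t\<bar> * indicator {p<..<q} t \<partial>lborel) = (\<integral>\<^sup>+t. ennreal \<bar>t\<bar> * indicator {p..q} t \<partial>lborel)"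
    using AE_lborel_singleton[of p] AE_lborel_singleton[of q]
    by (intro nn_integral_cong_AE) (auto split: split_indicator)
  also have "\<dots> = ennreal (half_sgn_sq q - half_sgn_sq p)"
    using \<open>p \<le> q\<close> by (intro nn_integral_FTC_Icc) (auto intro: has_field_derivative_at_within DERIV_half_sgn_sq)
  finally show "emeasure (distr (density lborel (\<lambda>t. ennreal \<bar>t\<bar>)) borel half_sgn_sq) (box l u)
      = ennreal (\<Prod>b\<in>Basis. (u - l) \<bullet> b)"
    by (simp add: pq)
qed simp

lemma nn_integral_half_sgn_sq:
  assumes [measurable]: "f \<in> borel_measurable borel"
  shows "(\<integral>\<^sup>+t. ennreal \<bar>t\<bar> * f (half_sgn_sq t) \<partial>lborel) = (\<integral>\<^sup>+u. f u \<partial>lborel)"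
proof -
  have "(\<integral>\<^sup>+u. f u \<partial>lborel) = (\<integral>\<^sup>+u. f u \<partial>distr (density lborel (\<lambda>t. ennreal \<bar>t\<bar>)) borel half_sgn_sq)"
    by (simp add: distr_half_sgn_sq)
  also have "\<dots> = (\<integral>\<^sup>+t. ennreal \<bar>t\<bar> * f (half_sgn_sq t) \<partial>lborel)"
    by (subst nn_integral_distr) (auto simp: nn_integral_density)
  finally show ?thesis by simp
qed

text \<open>The map \<open>(\<gamma>\<^sub>1, \<gamma>\<^sub>2)\<close> preserves Lebesgue measure: for fixed \<open>\<xi>\<^sub>1\<close> the second coordinate is
  scaled by \<open>1 / \<bar>\<xi>\<^sub>1\<bar>\<close>, which cancels the derivative \<open>\<bar>\<xi>\<^sub>1\<bar>\<close> of \<open>\<gamma>\<^sub>1\<close>.\<close>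

lemma nn_integral_\<gamma>:
  fixes F :: "real \<times> real \<Rightarrow> ennreal"
  assumes F [measurable]: "F \<in> borel_measurable borel" and a: "a > 0" and c: "c > 0"
  shows "(\<integral>\<^sup>+\<xi>. F (a * \<gamma>1 \<xi>, c * \<gamma>2 \<xi>) \<partial>lborel) = ennreal (1 / (a * c)) * (\<integral>\<^sup>+z. F z \<partial>lborel)"
proof -
  have F' [measurable]: "F \<in> borel_measurable (borel \<Otimes>\<^sub>M borel)"
    using F by (simp add: borel_prod)
  define H where "H u = (\<integral>\<^sup>+v. F (u, v) \<partial>lborel)" for u
  have H [measurable]: "H \<in> borel_measurable borel"
    unfolding H_def[abs_def] by measurable
  have "(\<integral>\<^sup>+\<xi>. F (a * \<gamma>1 \<xi>, c * \<gamma>2 \<xi>) \<partial>lborel)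
      = (\<integral>\<^sup>+\<xi>. F (a * \<gamma>1 \<xi>, c * \<gamma>2 \<xi>) \<partial>(lborel \<Otimes>\<^sub>M lborel))"
    by (simp add: lborel_prod)
  also have "\<dots> = (\<integral>\<^sup>+t. \<integral>\<^sup>+s. F (a * \<gamma>1 (t, s), c * \<gamma>2 (t, s)) \<partial>lborel \<partial>lborel)"
    by (subst lborel.nn_integral_fst[symmetric]) (auto simp: borel_prod lborel_prod)
  also have "\<dots> = (\<integral>\<^sup>+t. ennreal \<bar>t\<bar> * (ennreal (1 / c) * H (a * half_sgn_sq t)) \<partial>lborel)"
  proof (rule nn_integral_cong_AE)
    show "AE t in lborel. (\<integral>\<^sup>+s. F (a * \<gamma>1 (t, s), c * \<gamma>2 (t, s)) \<partial>lborel)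
        = ennreal \<bar>t\<bar> * (ennreal (1 / c) * H (a * half_sgn_sq t))"
      using AE_lborel_singleton[of 0]
    proof eventually_elim
      fix t :: real assume t: "t \<noteq> 0"
      let ?A = "a * half_sgn_sq t"
      \<comment> \<open>Substitution v = (c / t) s, which is \<open>c * \<gamma>2 (t, s)\<close>;
        the absolute value handles negative t.\<close>
      have "H ?A = ennreal \<bar>c / t\<bar> * (\<integral>\<^sup>+s. F (?A, 0 + (c / t) * s) \<partial>lborel)"
        unfolding H_def using t c by (intro nn_integral_real_affine) auto
      then have "ennreal \<bar>t / c\<bar> * H ?A = (ennreal \<bar>t / c\<bar> * ennreal \<bar>c / t\<bar>) * (\<integral>\<^sup>+s. F (?A, (c / t) * s) \<partial>lborel)"
        by (simp add: mult.assoc)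
      also have "ennreal \<bar>t / c\<bar> * ennreal \<bar>c / t\<bar> = 1"
        using t c by (simp add: ennreal_mult[symmetric] abs_mult[symmetric])
      also have "(\<integral>\<^sup>+s. F (?A, (c / t) * s) \<partial>lborel) = (\<integral>\<^sup>+s. F (a * \<gamma>1 (t, s), c * \<gamma>2 (t, s)) \<partial>lborel)"
        by (simp add: \<gamma>1_def \<gamma>2_def half_sgn_sq_altdef)
      also have "ennreal \<bar>t / c\<bar> * H ?A = ennreal \<bar>t\<bar> * (ennreal (1 / c) * H ?A)"
        using c by (simp add: mult.assoc[symmetric] ennreal_mult[symmetric])
      finally show "(\<integral>\<^sup>+s. F (a * \<gamma>1 (t, s), c * \<gamma>2 (t, s)) \<partial>lborel) = ennreal \<bar>t\<bar> * (ennreal (1 / c) * H ?A)"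
        by simp
    qed
  qed
  also have "\<dots> = (\<integral>\<^sup>+u. ennreal (1 / c) * H (a * u) \<partial>lborel)"
    by (rule nn_integral_half_sgn_sq) measurable
  also have "\<dots> = ennreal (1 / c) * (\<integral>\<^sup>+u. H (a * u) \<partial>lborel)"
    by (rule nn_integral_cmult) measurable
  also have "(\<integral>\<^sup>+u. H (a * u) \<partial>lborel) = ennreal (1 / a) * (\<integral>\<^sup>+u. H u \<partial>lborel)"
    using nn_integral_real_affine[OF H, of a 0] a
    by (simp add: mult.assoc[symmetric] ennreal_mult[symmetric])
  also have "(\<integral>\<^sup>+u. H u \<partial>lborel) = (\<integral>\<^sup>+z. F z \<partial>lborel)"
    unfolding H_def by (subst lborel.nn_integral_fst) (auto simp: lborel_prod borel_prod)
  also have "ennreal (1 / c) * (ennreal (1 / a) * I) = ennreal (1 / (a * c)) * I" for I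
  proof -
    have "ennreal (1 / c) * ennreal (1 / a) = ennreal (1 / (a * c))"
      using a c by (subst ennreal_mult[symmetric]) (auto simp: mult.commute)
    then show ?thesis by (metis mult.assoc)
  qed
  finally show ?thesis .
qed

text \<open>The statement at the level of measures, so that complex integrals can be transported as
  well as nonnegative ones.\<close>

lemma distr_\<gamma>:
  assumes "a > 0" "c > 0"
  shows "distr lborel borel (\<lambda>\<xi>. (a * \<gamma>1 \<xi>, c * \<gamma>2 \<xi>)) = density lborel (\<lambda>_. ennreal (1 / (a * c)))"
proof (rule measure_eqI)
  fix A assume "A \<in> sets (distr lborel borel (\<lambda>\<xi>. (a * \<gamma>1 \<xi>, c * \<gamma>2 \<xi>)))"
  then have A [measurable]: "A \<in> sets borel" by simp
  have m: "(\<lambda>\<xi>. (a * \<gamma>1 \<xi>, c * \<gamma>2 \<xi>)) \<in> borel_measurable borel" by measurable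
  have "emeasure (distr lborel borel (\<lambda>\<xi>. (a * \<gamma>1 \<xi>, c * \<gamma>2 \<xi>))) A
      = (\<integral>\<^sup>+\<xi>. indicator A (a * \<gamma>1 \<xi>, c * \<gamma>2 \<xi>) \<partial>lborel)"
  proof -
    have "(\<integral>\<^sup>+z. indicator A z \<partial>distr lborel borel (\<lambda>\<xi>. (a * \<gamma>1 \<xi>, c * \<gamma>2 \<xi>)))
        = (\<integral>\<^sup>+\<xi>. indicator A (a * \<gamma>1 \<xi>, c * \<gamma>2 \<xi>) \<partial>lborel)"
      using m by (intro nn_integral_distr) auto
    then show ?thesis by simp
  qed
  also have "\<dots> = ennreal (1 / (a * c)) * (\<integral>\<^sup>+z. indicator A z \<partial>lborel)"
    using assms by (intro nn_integral_\<gamma>) auto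
  also have "\<dots> = emeasure (density lborel (\<lambda>_. ennreal (1 / (a * c)))) A"
    by (subst emeasure_density) (auto simp: nn_integral_cmult)
  finally show "emeasure (distr lborel borel (\<lambda>\<xi>. (a * \<gamma>1 \<xi>, c * \<gamma>2 \<xi>))) A
    = emeasure (density lborel (\<lambda>_. ennreal (1 / (a * c)))) A" .
qed simp

lemma integral_\<gamma>_prod:
  fixes p q :: "real \<Rightarrow> complex"
  assumes p: "integrable lborel p" and q: "integrable lborel q" and a: "a > 0" and c: "c > 0"
  shows "integrable lborel (\<lambda>\<xi>. p (a * \<gamma>1 \<xi>) * q (c * \<gamma>2 \<xi>))" (is ?I)
    and "(LINT \<xi>|lborel. p (a * \<gamma>1 \<xi>) * q (c * \<gamma>2 \<xi>)) = of_real (1 / (a * c)) * (integral\<^sup>L lborel p * integral\<^sup>L lborel q)"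
      (is ?E)
proof -
  have [measurable]: "p \<in> borel_measurable borel" "q \<in> borel_measurable borel"
    using borel_measurable_integrable[OF p] borel_measurable_integrable[OF q] by simp_all
  define F where "F z = p (fst z) * q (snd z)" for z :: "real \<times> real"
  have F [measurable]: "F \<in> borel_measurable borel"
    unfolding F_def[abs_def] borel_prod[symmetric] by measurable
  have F_int: "integrable (lborel \<Otimes>\<^sub>M lborel) F"
    unfolding F_def[abs_def] using p q
    by (intro lborel_pair.Fubini_integrable) (auto simp: norm_mult borel_prod)
  have F_eq: "integral\<^sup>L (lborel \<Otimes>\<^sub>M lborel) F = integral\<^sup>L lborel p * integral\<^sup>L lborel q"
    using lborel_pair.integral_fst'[OF F_int] by (simp add: F_def)
  have m: "(\<lambda>\<xi>. (a * \<gamma>1 \<xi>, c * \<gamma>2 \<xi>)) \<in> measurable lborel borel" by measurable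
  let ?D = "density lborel (\<lambda>_. ennreal (1 / (a * c))) :: (real \<times> real) measure"
  have ac: "0 \<le> 1 / (a * c)" using a c by simp
  have "integrable ?D F"
    using F_int ac by (subst integrable_density) (auto simp: lborel_prod)
  then have "integrable (distr lborel borel (\<lambda>\<xi>. (a * \<gamma>1 \<xi>, c * \<gamma>2 \<xi>))) F"
    by (simp add: distr_\<gamma> a c)
  then show ?I
    using m by (subst (asm) integrable_distr_eq) (auto simp: F_def)
  have "(LINT \<xi>|lborel. p (a * \<gamma>1 \<xi>) * q (c * \<gamma>2 \<xi>)) = (LINT \<xi>|lborel. F (a * \<gamma>1 \<xi>, c * \<gamma>2 \<xi>))"
    by (simp add: F_def)
  also have "\<dots> = integral\<^sup>L (distr lborel borel (\<lambda>\<xi>. (a * \<gamma>1 \<xi>, c * \<gamma>2 \<xi>))) F"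
    using m F by (intro integral_distr[symmetric]) auto
  also have "\<dots> = integral\<^sup>L ?D F" by (simp add: distr_\<gamma> a c)
  also have "\<dots> = (1 / (a * c)) *\<^sub>R integral\<^sup>L lborel F"
    using ac F by (subst integral_density) auto
  also have "integral\<^sup>L lborel F = integral\<^sup>L (lborel \<Otimes>\<^sub>M lborel) F" by (simp add: lborel_prod)
  finally show ?E by (simp add: F_eq scaleR_conv_of_real)
qed


section \<open>The frames on the plane\<close>

text \<open>The constant \<open>s\<close> is the square root of \<open>a * c\<close> up to sign: s^2
  cancels the factor 1/(a c) of the substitution, and Fubini splits what remains.\<close>

lemma
  fixes p q p' q' :: "real \<Rightarrow> complex" and s a c :: real
  assumes p: "p \<in> sq_integrable" "p' \<in> sq_integrable" and q: "q \<in> sq_integrable" "q' \<in> sq_integrable"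
    and ac: "a > 0" "c > 0" and s: "s * s = a * c"
  shows sq_integrable_\<gamma>: "(\<lambda>\<xi>. s * p (a * \<gamma>1 \<xi>) * q (c * \<gamma>2 \<xi>)) \<in> sq_integrable"
    and l2_inner_\<gamma>: "l2_inner (\<lambda>\<xi>. s * p (a * \<gamma>1 \<xi>) * q (c * \<gamma>2 \<xi>)) (\<lambda>\<xi>. s * p' (a * \<gamma>1 \<xi>) * q' (c * \<gamma>2 \<xi>))
      = l2_inner p p' * l2_inner q q'"
proof -
  note [measurable] = sq_integrableD(1)[OF p(1)] sq_integrableD(1)[OF q(1)]
  note pp = integral_\<gamma>_prod[OF l2_inner_integrable[OF p] l2_inner_integrable[OF q] ac]
  have "integrable lborel (\<lambda>\<xi>. (s * s) * cmod ((p (a * \<gamma>1 \<xi>) * cnj (p (a * \<gamma>1 \<xi>))) * (q (c * \<gamma>2 \<xi>) * cnj (q (c * \<gamma>2 \<xi>)))))"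
    by (intro integrable_mult_right integrable_norm integral_\<gamma>_prod l2_inner_integrable p q ac)
  moreover have "(s * s) * cmod ((p (a * \<gamma>1 \<xi>) * cnj (p (a * \<gamma>1 \<xi>))) * (q (c * \<gamma>2 \<xi>) * cnj (q (c * \<gamma>2 \<xi>))))
      = (cmod (s * p (a * \<gamma>1 \<xi>) * q (c * \<gamma>2 \<xi>)))\<^sup>2" for \<xi>
    by (simp add: norm_mult power2_eq_square)
  ultimately have "integrable lborel (\<lambda>\<xi>. (cmod (s * p (a * \<gamma>1 \<xi>) * q (c * \<gamma>2 \<xi>)))\<^sup>2)"
    by simp
  moreover have "(\<lambda>\<xi>. s * p (a * \<gamma>1 \<xi>) * q (c * \<gamma>2 \<xi>)) \<in> borel_measurable borel"
    by measurable
  ultimately show "(\<lambda>\<xi>. s * p (a * \<gamma>1 \<xi>) * q (c * \<gamma>2 \<xi>)) \<in> sq_integrable"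
    by (simp add: sq_integrable_def)
  have "l2_inner (\<lambda>\<xi>. s * p (a * \<gamma>1 \<xi>) * q (c * \<gamma>2 \<xi>)) (\<lambda>\<xi>. s * p' (a * \<gamma>1 \<xi>) * q' (c * \<gamma>2 \<xi>))
      = (LINT \<xi>|lborel. of_real (s * s) * ((p (a * \<gamma>1 \<xi>) * cnj (p' (a * \<gamma>1 \<xi>))) * (q (c * \<gamma>2 \<xi>) * cnj (q' (c * \<gamma>2 \<xi>)))))"
    unfolding l2_inner_def by (intro Bochner_Integration.integral_cong refl) (simp add: mult_ac)
  also have "\<dots> = of_real (s * s) * (of_real (1 / (a * c)) * (l2_inner p p' * l2_inner q q'))"
    unfolding l2_inner_def pp(2)[symmetric] by (rule integral_mult_right_zero)
  also have "\<dots> = l2_inner p p' * l2_inner q q'"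
    using ac unfolding s by simp
  finally show "l2_inner (\<lambda>\<xi>. s * p (a * \<gamma>1 \<xi>) * q (c * \<gamma>2 \<xi>)) (\<lambda>\<xi>. s * p' (a * \<gamma>1 \<xi>) * q' (c * \<gamma>2 \<xi>))
      = l2_inner p p' * l2_inner q q'" .
qed

text \<open>Regroups the five factors as a tensor product: \<open>m1\<close> modulates the transform
  in the first variable, while \<open>m2\<close> and \<open>k\<close> form a Gabor function in the
  second. The product with \<open>m1\<close> is written as an inner product to match the translation
  rule.\<close>

lemma atom_hat_eq:
  "atom_hat b w g j (k, m1, m2) = (\<lambda>\<xi>. complex_of_real (2 powr (- 3 * of_int j / 2))
     * (cis (2 * pi * (of_int m1 \<bullet> (2 powi (- 4 * j) * \<gamma>1 \<xi>))) * fourier_L2 g (2 powi (- 4 * j) * \<gamma>1 \<xi>))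
     * gabor b w (m2, k) (2 powi j * \<gamma>2 \<xi>))"
  by (simp add: atom_hat_def gabor_def mult_ac)

lemma powr_scale_sq:
  "2 powr (- 3 * of_int j / 2) * 2 powr (- 3 * of_int j / 2) = (2 powi (- 4 * j) * 2 powi j :: real)"
proof -
  have "2 powr (- 3 * of_int j / 2) * 2 powr (- 3 * of_int j / 2) = (2 :: real) powr of_int (- 3 * j)"
    by (simp add: powr_add[symmetric])
  also have "\<dots> = 2 powi (- 3 * j)" by (rule powr_real_of_int') simp_all
  also have "\<dots> = 2 powi (- 4 * j) * 2 powi j" by (subst power_int_add[symmetric]) auto
  finally show ?thesis .
qed

text \<open>After the substitution, Parseval in one variable returns the first factor from modulated
  transforms to integer translates, where orthonormality is known.\<close>

lemma
  assumes g: "g \<in> sq_integrable" "g' \<in> sq_integrable" and w: "\<And>n. gabor b w n \<in> sq_integrable"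
  shows sq_integrable_atom_hat: "atom_hat b w g j (k, m1, m2) \<in> sq_integrable"
    and l2_inner_atom_hat: "l2_inner (atom_hat b w g j (k, m1, m2)) (atom_hat b w g' j (k', m1', m2'))
      = l2_inner (\<lambda>x. g (x + of_int m1)) (\<lambda>x. g' (x + of_int m1')) * l2_inner (gabor b w (m2, k)) (gabor b w (m2', k'))"
proof -
  note T = has_fourier_L2_translate[OF has_fourier_L2_fourier_L2]
  note p = has_fourier_L2D(2)[OF T[OF g(1), of "of_int m1"]] has_fourier_L2D(2)[OF T[OF g(2), of "of_int m1'"]]
  have pos: "(2 powi (- 4 * j) :: real) > 0" "(2 powi j :: real) > 0" by simp_all
  show "atom_hat b w g j (k, m1, m2) \<in> sq_integrable"
    unfolding atom_hat_eq by (rule sq_integrable_\<gamma>[OF p(1) p(1) w w pos powr_scale_sq])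
  show "l2_inner (atom_hat b w g j (k, m1, m2)) (atom_hat b w g' j (k', m1', m2'))
      = l2_inner (\<lambda>x. g (x + of_int m1)) (\<lambda>x. g' (x + of_int m1')) * l2_inner (gabor b w (m2, k)) (gabor b w (m2', k'))"
    unfolding atom_hat_eq l2_inner_\<gamma>[OF p w w pos powr_scale_sq]
    by (simp only: has_fourier_L2_inner[OF T[OF g(1)] T[OF g(2)]])
qed

lemma l2_norm_gabor:
  assumes "w \<in> borel_measurable borel" shows "l2_norm (gabor b w n) = l2_norm w"
proof -
  obtain m k where n: "n = (m, k)" by (cases n)
  have "l2_norm (gabor b w n) = l2_norm (\<lambda>x. w (x + (- of_int k)))"
    by (simp add: n gabor_def l2_norm_def norm_mult)
  also have "\<dots> = l2_norm w" by (rule l2_norm_translate[OF assms])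
  finally show ?thesis .
qed

text \<open>Treats both families at once: the label set \<open>L\<close> is a singleton for the
  scaling function and {1..15} for the wavelets. The orthonormal index is the label with
  \<open>m1\<close>, the Gabor index is (m2, k).\<close>

lemma unit_norm_tight_frame_atoms:
  fixes G :: "'l \<Rightarrow> real \<Rightarrow> complex" and lab :: "'i \<Rightarrow> 'l" and idx :: "'i \<Rightarrow> int \<times> int \<times> int"
  assumes G: "\<And>l. l \<in> L \<Longrightarrow> G l \<in> sq_integrable"
    and orth: "\<And>l l' k k'. l \<in> L \<Longrightarrow> l' \<in> L \<Longrightarrow>
      l2_inner (\<lambda>x. G l (x - of_int k)) (\<lambda>x. G l' (x - of_int k')) = (if l = l' \<and> k = k' then 1 else 0)"
    and b: "b > 0" and w: "w \<in> sq_integrable" "l2_norm w = 1"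
    and gab: "tight_frame (inverse b) (gabor b w) UNIV sq_integrable"
    and bij: "bij_betw (\<lambda>i. (lab i, idx i)) J (L \<times> UNIV)"
    and u: "\<And>i. i \<in> J \<Longrightarrow> u i = inverse_fourier_L2 (atom_hat b w (G (lab i)) j (idx i))"
  shows "unit_norm_tight_frame (inverse b) u J (closed_span u J)"
proof -
  have gL: "gabor b w n \<in> sq_integrable" for n
    using gab unfolding tight_frame_def by blast
  have lab: "lab i \<in> L" if "i \<in> J" for i
    using bij_betw_apply[OF bij that] by simp
  define p where "p i = (case idx i of (k, m1, m2) \<Rightarrow> (lab i, m1))" for i
  define q where "q i = (case idx i of (k, m1, m2) \<Rightarrow> (m2, k))" for i
  have atom_L2: "atom_hat b w (G l) j i \<in> sq_integrable" if "l \<in> L" for l i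
    by (cases i) (auto intro!: sq_integrable_atom_hat G gL that)
  have uF: "has_fourier_L2 (u i) (atom_hat b w (G (lab i)) j (idx i))" if "i \<in> J" for i
    unfolding u[OF that] by (rule has_fourier_L2_inverse_fourier_L2[OF atom_L2[OF lab[OF that]]])
  have gram: "l2_inner (u i) (u i') = (if p i = p i' then l2_inner (gabor b w (q i)) (gabor b w (q i')) else 0)"
    if i: "i \<in> J" "i' \<in> J" for i i'
  proof -
    obtain k m1 m2 where [simp]: "idx i = (k, m1, m2)" by (cases "idx i")
    obtain k' m1' m2' where [simp]: "idx i' = (k', m1', m2')" by (cases "idx i'")
    have "l2_inner (u i) (u i') = l2_inner (atom_hat b w (G (lab i)) j (k, m1, m2)) (atom_hat b w (G (lab i')) j (k', m1', m2'))"
      using has_fourier_L2_inner[OF uF[OF i(1)] uF[OF i(2)]] by simp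
    also have "\<dots> = l2_inner (\<lambda>x. G (lab i) (x + of_int m1)) (\<lambda>x. G (lab i') (x + of_int m1'))
        * l2_inner (gabor b w (m2, k)) (gabor b w (m2', k'))"
      by (intro l2_inner_atom_hat G lab i gL)
    also have "l2_inner (\<lambda>x. G (lab i) (x + of_int m1)) (\<lambda>x. G (lab i') (x + of_int m1'))
        = (if lab i = lab i' \<and> m1 = m1' then 1 else 0)"
      \<comment> \<open>The atoms carry translates by \<open>+m1\<close>, the orthonormality
        hypothesis those by \<open>-k\<close>.\<close>
      using orth[OF lab[OF i(1)] lab[OF i(2)], of "- m1" "- m1'"] by simp
    finally show ?thesis by (simp add: p_def q_def)
  qed
  have bij': "bij_betw (\<lambda>i. (p i, q i)) J ((L \<times> UNIV) \<times> UNIV)"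
  proof -
    have "bij_betw (\<lambda>(l, k, m1, m2). ((l, m1), (m2, k))) (L \<times> (UNIV :: (int \<times> int \<times> int) set)) ((L \<times> UNIV) \<times> UNIV)"
      by (rule bij_betw_byWitness[where f'="\<lambda>((l, m1), (m2, k)). (l, k, m1, m2)"]) auto
    from bij_betw_trans[OF bij this] show ?thesis
      by (rule bij_betw_cong[THEN iffD1, rotated]) (auto simp: p_def q_def split: prod.split)
  qed
  have "tight_frame (inverse b) u J (closed_span u J)"
    using b by (intro tight_frame_tensor_gram[OF _ _ gab bij' gram] has_fourier_L2D(1)[OF uF]) auto
  moreover have "l2_norm (u i) = 1" if "i \<in> J" for i
  proof -
    \<comment> \<open>A diagonal Gram entry is the squared norm of a Gabor function, hence of the
      window.\<close>
    have "complex_of_real ((l2_norm (u i))\<^sup>2) = complex_of_real ((l2_norm (gabor b w (q i)))\<^sup>2)"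
      using gram[OF that that] unfolding l2_inner_self by simp
    then have "(l2_norm (u i))\<^sup>2 = (l2_norm (gabor b w (q i)))\<^sup>2"
      by (simp only: of_real_eq_iff)
    then show ?thesis
      using l2_norm_gabor[OF sq_integrableD(1)[OF w(1)]] w(2) l2_norm_nonneg[of "u i"]
      by (simp add: power2_eq_1_iff)
  qed
  ultimately show ?thesis by (simp add: unit_norm_tight_frame_def)
qed

theorem theorem3p1:
  fixes U :: "int \<Rightarrow> (real \<Rightarrow> complex) set"
    and \<phi> w :: "real \<Rightarrow> complex"
    and \<psi> :: "nat \<Rightarrow> real \<Rightarrow> complex"
    and b :: real
  assumes mra: "orthogonal_mra 16 U \<phi>"
    and wavelets: "orthonormal_wavelets 16 U \<psi>"
    and b: "b > 0"
    and w_L2: "w \<in> sq_integrable"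
    and w_norm: "l2_norm w = 1"
    and w_gabor: "tight_frame (inverse b) (gabor b w) UNIV sq_integrable"
  shows "\<forall>j. unit_norm_tight_frame (inverse b) (Phi b w \<phi> j) UNIV (scaling_space b w \<phi> j) \<and>
             unit_norm_tight_frame (inverse b) (Psi b w \<psi> j) ({1..15} \<times> UNIV)
               (wavelet_space b w \<psi> j)"
proof (intro allI conjI)
  fix j
  have U_L2: "U i \<subseteq> sq_integrable" for i
    using mra by (simp add: orthogonal_mra_def closed_subspace_def)
  have \<phi>_onb: "orthonormal_basis (\<lambda>(k::int) x. \<phi> (x - of_int k)) UNIV (U 0)"
    using mra by (simp add: orthogonal_mra_def)
  \<comment> \<open>The zero translate places the scaling function itself in \<open>U 0\<close>,
    hence in L2.\<close>
  then have "(\<lambda>x. \<phi> (x - of_int 0)) \<in> U 0" by (simp only: orthonormal_basis_def) blast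
  then have \<phi>_L2: "\<phi> \<in> sq_integrable" using U_L2 by auto
  show "unit_norm_tight_frame (inverse b) (Phi b w \<phi> j) UNIV (scaling_space b w \<phi> j)"
    unfolding scaling_space_def
  proof (rule unit_norm_tight_frame_atoms[where L="{()}" and G="\<lambda>_. \<phi>" and lab="\<lambda>_. ()" and idx="\<lambda>i. i"])
    show "bij_betw (\<lambda>i. ((), i)) UNIV ({()} \<times> UNIV)"
      by (rule bij_betw_byWitness[where f'=snd]) auto
    show "l2_inner (\<lambda>x. \<phi> (x - of_int k)) (\<lambda>x. \<phi> (x - of_int k')) = (if l = l' \<and> k = k' then 1 else 0)"
      for l l' :: unit and k k'
      using \<phi>_onb by (simp add: orthonormal_basis_def)
    show "Phi b w \<phi> j i = inverse_fourier_L2 (atom_hat b w \<phi> j i)" for i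
      by (cases i) (simp add: Phi_def)
  qed (use \<phi>_L2 b w_L2 w_norm w_gabor in simp_all)
  let ?\<psi> = "\<lambda>(l, k::int) x. \<psi> l (x - of_int k)"
  have \<psi>_onb: "orthonormal_basis ?\<psi> ({1..<16} \<times> UNIV) {f \<in> U 1. \<forall>g\<in>U 0. l2_inner f g = 0}"
    using wavelets by (simp add: orthonormal_wavelets_def)
  have \<psi>_L2: "\<psi> l \<in> sq_integrable" if "l \<in> {1..15}" for l
  proof -
    \<comment> \<open>The wavelets are indexed by {1..<16} with M = 16, the frame by {1..15}; over
      the naturals these agree.\<close>
    have "(l, 0) \<in> {1..<16} \<times> (UNIV :: int set)" using that by auto
    then have "?\<psi> (l, 0) \<in> U 1" using \<psi>_onb unfolding orthonormal_basis_def by blast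
    then show ?thesis using U_L2 by auto
  qed
  show "unit_norm_tight_frame (inverse b) (Psi b w \<psi> j) ({1..15} \<times> UNIV) (wavelet_space b w \<psi> j)"
    unfolding wavelet_space_def
  proof (rule unit_norm_tight_frame_atoms[where L="{1..15}" and G=\<psi> and lab=fst and idx=snd])
    show "l2_inner (\<lambda>x. \<psi> l (x - of_int k)) (\<lambda>x. \<psi> l' (x - of_int k')) = (if l = l' \<and> k = k' then 1 else 0)"
      if "l \<in> {1..15}" "l' \<in> {1..15}" for l l' k k'
    proof -
      have "(l, k) \<in> {1..<16} \<times> UNIV" "(l', k') \<in> {1..<16} \<times> UNIV" using that by auto
      then have "l2_inner (?\<psi> (l, k)) (?\<psi> (l', k')) = (if (l, k) = (l', k') then 1 else 0)"
        using \<psi>_onb unfolding orthonormal_basis_def by blast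
      then show ?thesis by simp
    qed
    show "Psi b w \<psi> j i = inverse_fourier_L2 (atom_hat b w (\<psi> (fst i)) j (snd i))" for i
      by (cases i) (simp add: Psi_def)
    show "bij_betw (\<lambda>i. (fst i, snd i)) ({1..15::nat} \<times> UNIV) ({1..15} \<times> UNIV)"
      by (rule bij_betw_byWitness[where f'="\<lambda>i. i"]) auto
  qed (use \<psi>_L2 b w_L2 w_norm w_gabor in simp_all)
qed

end
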